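(* Let $k\geq 1$ be an integer and let $\delta>0$. Then there exist $\eta>0$ and $n_0$ such that the following holds: let $n\ge n_0$ and let $\Gamma$ be an $(n,d,\lambda)$-graph satisfying $\lambda^{2k-1}\le \eta\, d^{2k}/n$. If $G\subseteq\Gamma$ is a subgraph such that $e(G)\ge \left(\tfrac12+\delta\right)\tfrac{d}{n}\binom{n}{2}$, then $G$ contains a copy of $C_{2k+1}$.
   Context: An $(n,d,\lambda)$-graph is a $d$-regular graph on $n$ vertices such that the eigenvalues $d=\lambda_1\ge\lambda_2\ge\dots\ge\lambda_n$ of its adjacency matrix satisfy $|\lambda_i|\le\lambda$ for all $i=2,\dots,n$. $C_{2k+1}$ denotes the cycle of length $2k+1$.
   Formalization: The degree is assumed to satisfy d ≥ 1; for d = 0 the claim fails, since the edgeless graph on n vertices (λ = 0, G = Γ) meets every hypothesis but contains no cycle. *)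

theory Defs
  imports Complex_Main "Jordan_Normal_Form.Char_Poly"
begin

definition simple_graph :: "'a set \<Rightarrow> 'a set set \<Rightarrow> bool" where
  "simple_graph V E \<longleftrightarrow> finite V \<and> (\<forall>e\<in>E. e \<subseteq> V \<and> card e = 2)"

definition subgraph_of :: "'a set \<Rightarrow> 'a set set \<Rightarrow> 'a set \<Rightarrow> 'a set set \<Rightarrow> bool" where
  "subgraph_of W F V E \<longleftrightarrow> simple_graph W F \<and> W \<subseteq> V \<and> F \<subseteq> E"

definition regular_graph :: "nat \<Rightarrow> 'a set \<Rightarrow> 'a set set \<Rightarrow> bool" where
  "regular_graph d V E \<longleftrightarrow> simple_graph V E \<and> (\<forall>v\<in>V. card {e \<in> E. v \<in> e} = d)"

text \<open>The list \<open>vs\<close> enumerates the vertices. The diagonal vanishes for a simple graph,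
  since \<open>{v, v}\<close> has only one element and hence is not an edge.\<close>

definition adjacency_matrix :: "'a list \<Rightarrow> 'a set set \<Rightarrow> real mat" where
  "adjacency_matrix vs E =
     mat (length vs) (length vs) (\<lambda>(i, j). if {vs ! i, vs ! j} \<in> E then 1 else 0)"

text \<open>\<open>es\<close> lists all eigenvalues of \<open>A\<close>, with multiplicity, in non-increasing order; at most
  one list has this property.\<close>

definition ordered_eigenvalues :: "real mat \<Rightarrow> real list \<Rightarrow> bool" where
  "ordered_eigenvalues A es \<longleftrightarrow>
     char_poly A = (\<Prod>\<mu>\<leftarrow>es. [:- \<mu>, 1:]) \<and> sorted_wrt (\<ge>) es"

text \<open>The choice of the enumeration \<open>vs\<close> is immaterial: another one conjugates the adjacency
  matrix by a permutation matrix. List indices start at 0, so \<open>es ! 0\<close> is the largest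
  eigenvalue \<open>\<lambda>\<^sub>1\<close>.\<close>

definition ndl_graph :: "nat \<Rightarrow> nat \<Rightarrow> real \<Rightarrow> 'a set \<Rightarrow> 'a set set \<Rightarrow> bool" where
  "ndl_graph n d l V E \<longleftrightarrow>
     regular_graph d V E \<and> card V = n \<and> n \<ge> 1 \<and>
     (\<exists>vs es. distinct vs \<and> set vs = V \<and>
        ordered_eigenvalues (adjacency_matrix vs E) es \<and> length es = n \<and>
        es ! 0 = real d \<and> (\<forall>i\<in>{1..<n}. \<bar>es ! i\<bar> \<le> l))"

definition contains_copy :: "'a set \<Rightarrow> 'a set set \<Rightarrow> 'b set \<Rightarrow> 'b set set \<Rightarrow> bool" where
  "contains_copy V E W F \<longleftrightarrow> (\<exists>f. inj_on f W \<and> f ` W \<subseteq> V \<and> (\<forall>e\<in>F. f ` e \<in> E))"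

definition cycle_verts :: "nat \<Rightarrow> nat set" where
  "cycle_verts m = {..<m}"

text \<open>This is the cycle of length \<open>m\<close> for \<open>m \<ge> 3\<close> only.\<close>

definition cycle_edges :: "nat \<Rightarrow> nat set set" where
  "cycle_edges m = {{i, (i + 1) mod m} | i. i < m}"

end

theory Submission
  imports Defs "Jordan_Normal_Form.Schur_Decomposition" "HOL-Analysis.Convex"
begin

text \<open>
  Let \<open>A\<close> and \<open>B \<le> A\<close> be the adjacency matrices of \<open>\<Gamma>\<close> and \<open>G\<close>, put \<open>m = 2k + 1\<close>, and let \<open>w\<^sub>j\<close> be
  the number of walks with \<open>j\<close> edges in \<open>G\<close>. Since \<open>tr (B\<^sup>m\<^sup>-\<^sup>2 (A - B)\<^sup>2) \<ge> 0\<close>,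
  we have \<open>tr B\<^sup>m \<ge> 2 tr (B\<^sup>2\<^sup>k A) - tr (B\<^sup>2\<^sup>k\<^sup>-\<^sup>1 A\<^sup>2)\<close>. Both traces on the right contain a factor \<open>A\<close>,
  and replacing \<open>A\<close> by its rank-one part \<open>(d/n) 1 1\<^sup>T\<close> costs only \<open>O(\<lambda> tr A\<^sup>2\<^sup>k)\<close>, which
  is small compared with \<open>d\<^sup>m\<close>. The main term is \<open>(d/n) (2 w\<^sub>2\<^sub>k - d w\<^sub>2\<^sub>k\<^sub>-\<^sub>1)\<close>. Log-convexity of moments
  gives \<open>n w\<^sub>2\<^sub>k \<ge> w\<^sub>1 w\<^sub>2\<^sub>k\<^sub>-\<^sub>1\<close>, and \<open>2 w\<^sub>1 \<ge> (1 + \<delta>) d n\<close>, so the main term is of order \<open>d\<^sup>m\<close>.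
  Finally, a closed walk of length \<open>m\<close> that is not a cycle splits at a repeated vertex into two shorter closed
  walks; the pointwise bound \<open>(A\<^sup>s)\<^sub>v\<^sub>v \<le> d\<^sup>s/n + \<lambda>\<^sup>s\<^sup>-\<^sup>2 d\<close> and \<open>\<lambda>\<^sup>2 \<ge> d/2\<close> (for \<open>d \<le> n/2\<close>) show
  that these make up a small fraction of \<open>d\<^sup>m\<close>.
\<close>

section \<open>Traces of powers of a matrix\<close>

lemma sum_diag_mult_comm:
  fixes X Y :: "'a::comm_semiring_0 mat"
  assumes X: "X \<in> carrier_mat n n" and Y: "Y \<in> carrier_mat n n"
  shows "(\<Sum>i<n. (X * Y) $$ (i, i)) = (\<Sum>i<n. (Y * X) $$ (i, i))"
proof -
  have "(\<Sum>i<n. (X * Y) $$ (i, i)) = (\<Sum>i<n. \<Sum>j<n. X $$ (i, j) * Y $$ (j, i))"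
    using X Y by (auto simp: scalar_prod_def lessThan_atLeast0 intro!: sum.cong)
  also have "\<dots> = (\<Sum>j<n. \<Sum>i<n. X $$ (i, j) * Y $$ (j, i))"
    by (rule sum.swap)
  also have "\<dots> = (\<Sum>j<n. (Y * X) $$ (j, j))"
    using X Y by (auto simp: scalar_prod_def lessThan_atLeast0 mult.commute intro!: sum.cong)
  finally show ?thesis .
qed

lemma pow_mat_Suc_entry:
  fixes B :: "'a::comm_ring_1 mat"
  assumes B: "B \<in> carrier_mat n n" and ij: "i < n" "j < n"
  shows "(B ^\<^sub>m Suc p) $$ (i, j) = (\<Sum>l<n. (B ^\<^sub>m p) $$ (i, l) * B $$ (l, j))"
proof -
  have C: "B ^\<^sub>m p \<in> carrier_mat n n" using B by simp
  show ?thesis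
    using B C ij by (auto simp: scalar_prod_def lessThan_atLeast0 intro!: sum.cong)
qed

text \<open>In row \<open>i\<close> and column \<open>j\<close> of the product only indices
  \<open>l\<close> with \<open>i \<le> l \<le> j\<close> contribute, so nothing appears below the
  diagonal and a diagonal entry has a single summand.\<close>

lemma upper_triangular_pow:
  fixes B :: "'a::comm_ring_1 mat"
  assumes B: "B \<in> carrier_mat n n" and ut: "upper_triangular B"
  shows "upper_triangular (B ^\<^sub>m p) \<and> (\<forall>i<n. (B ^\<^sub>m p) $$ (i, i) = (B $$ (i, i)) ^ p)"
proof (induction p)
  case 0
  then show ?case using B by auto
next
  case (Suc p)
  have C: "B ^\<^sub>m p \<in> carrier_mat n n" using B by simp
  note entry = pow_mat_Suc_entry[OF B, of _ _ p]
  have z1: "(B ^\<^sub>m p) $$ (i, l) = 0" if "l < i" "i < n" for i l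
    using Suc C that by (auto dest: upper_triangularD)
  have z2: "B $$ (i, l) = 0" if "l < i" "i < n" for i l
    using ut B that by (auto dest: upper_triangularD)
  have "upper_triangular (B ^\<^sub>m Suc p)"
  proof (rule upper_triangularI)
    fix i j assume ij: "j < i" "i < dim_row (B ^\<^sub>m Suc p)"
    have i: "i < n" using ij B by (simp add: pow_mat_dim_square)
    have "(B ^\<^sub>m p) $$ (i, l) * B $$ (l, j) = 0" if "l < n" for l
      using z1[of l i] z2[of j l] ij i that by (cases "l < i") auto
    then show "(B ^\<^sub>m Suc p) $$ (i, j) = 0"
      unfolding entry[OF i less_trans[OF ij(1) i]] by (auto intro!: sum.neutral)
  qed
  moreover have "(B ^\<^sub>m Suc p) $$ (i, i) = (B $$ (i, i)) ^ Suc p" if i: "i < n" for i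
  proof -
    have "(\<Sum>l<n. (B ^\<^sub>m p) $$ (i, l) * B $$ (l, i)) = (\<Sum>l<n. if l = i then (B ^\<^sub>m p) $$ (i, l) * B $$ (l, i) else 0)"
    proof (rule sum.cong)
      fix l assume "l \<in> {..<n}"
      then show "(B ^\<^sub>m p) $$ (i, l) * B $$ (l, i) = (if l = i then (B ^\<^sub>m p) $$ (i, l) * B $$ (l, i) else 0)"
        using z1[of l i] z2[of i l] i by (cases l i rule: linorder_cases) auto
    qed simp
    also have "\<dots> = (B ^\<^sub>m p) $$ (i, i) * B $$ (i, i)" using i by simp
    finally show ?thesis using entry[OF i i] Suc i by (simp add: mult.commute)
  qed
  ultimately show ?case by blast
qed

text \<open>Schur triangularisation writes \<open>A\<close> as \<open>P * B * Q\<close> with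
  \<open>Q * P\<close> the identity. Cyclicity of the trace removes \<open>P\<close> and
  \<open>Q\<close>, and the diagonal of the triangular matrix \<open>B\<close> is
  \<open>es\<close>.\<close>

lemma sum_diag_pow_eq_sum_list:
  fixes A :: "real mat"
  assumes A: "A \<in> carrier_mat n n" and c: "char_poly A = (\<Prod>e\<leftarrow>es. [:- e, 1:])"
  shows "(\<Sum>i<n. (A ^\<^sub>m p) $$ (i, i)) = (\<Sum>e\<leftarrow>es. e ^ p)"
proof -
  obtain B P Q where "schur_decomposition A es = (B, P, Q)"
    by (cases "schur_decomposition A es") auto
  from schur_decomposition[OF A c this]
  have sim: "similar_mat_wit A B P Q" and ut: "upper_triangular B" and diag: "diag_mat B = es"
    by auto
  from similar_mat_witD2[OF A sim] have B: "B \<in> carrier_mat n n" and P: "P \<in> carrier_mat n n"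
    and Q: "Q \<in> carrier_mat n n" and QP: "Q * P = 1\<^sub>m n" by auto
  have Bp: "B ^\<^sub>m p \<in> carrier_mat n n" using B by simp
  have "(\<Sum>i<n. (A ^\<^sub>m p) $$ (i, i)) = (\<Sum>i<n. ((P * B ^\<^sub>m p) * Q) $$ (i, i))"
    using similar_mat_wit_pow_id[OF sim, of p] by simp
  also have "\<dots> = (\<Sum>i<n. (Q * (P * B ^\<^sub>m p)) $$ (i, i))"
    by (rule sum_diag_mult_comm) (use P Q Bp in auto)
  also have "Q * (P * B ^\<^sub>m p) = B ^\<^sub>m p"
    using P Q Bp QP left_mult_one_mat[OF Bp] by (simp flip: assoc_mult_mat)
  also have "(\<Sum>i<n. (B ^\<^sub>m p) $$ (i, i)) = (\<Sum>i<n. (B $$ (i, i)) ^ p)"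
    using upper_triangular_pow[OF B ut] by simp
  also have "\<dots> = (\<Sum>e\<leftarrow>es. e ^ p)"
    using B unfolding diag[symmetric] diag_mat_def
    by (simp add: interv_sum_list_conv_sum_set_nat lessThan_atLeast0 comp_def)
  finally show ?thesis .
qed

section \<open>Kernels on a finite set\<close>

text \<open>Real matrices indexed by the vertices themselves; an enumeration of the vertices enters
  only together with the eigenvalues.\<close>

type_synonym 'a kernel = "'a \<Rightarrow> 'a \<Rightarrow> real"

locale finite_vertices =
  fixes V :: "'a set"
  assumes finite_V: "finite V"
begin

definition kmul :: "'a kernel \<Rightarrow> 'a kernel \<Rightarrow> 'a kernel" (infixl "\<star>" 70) where
  "K \<star> L = (\<lambda>u v. \<Sum>w\<in>V. K u w * L w v)"

text \<open>The zeroth power is cut off outside \<open>V\<close>, which makes it the unit among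
  kernels that vanish there.\<close>

primrec kpow :: "'a kernel \<Rightarrow> nat \<Rightarrow> 'a kernel" where
  "kpow K 0 = (\<lambda>u v. if u = v \<and> u \<in> V then 1 else 0)"
| "kpow K (Suc j) = K \<star> kpow K j"

definition ktrace :: "'a kernel \<Rightarrow> real" where
  "ktrace K = (\<Sum>v\<in>V. K v v)"

definition app :: "'a kernel \<Rightarrow> ('a \<Rightarrow> real) \<Rightarrow> 'a \<Rightarrow> real" where
  "app K f = (\<lambda>u. \<Sum>v\<in>V. K u v * f v)"

definition ip :: "('a \<Rightarrow> real) \<Rightarrow> ('a \<Rightarrow> real) \<Rightarrow> real" where
  "ip f g = (\<Sum>v\<in>V. f v * g v)"

definition supported :: "'a kernel \<Rightarrow> bool" where
  "supported K \<longleftrightarrow> (\<forall>u v. u \<notin> V \<or> v \<notin> V \<longrightarrow> K u v = 0)"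

definition ksym :: "'a kernel \<Rightarrow> bool" where
  "ksym K \<longleftrightarrow> (\<forall>u v. K u v = K v u)"

definition walks :: "'a kernel \<Rightarrow> nat \<Rightarrow> real" where
  "walks K j = ip (\<lambda>_. 1) (app (kpow K j) (\<lambda>_. 1))"

section \<open>Algebra of kernels\<close>

lemma kmul_assoc: "(K \<star> L) \<star> M = K \<star> (L \<star> M)"
proof (intro ext)
  fix u v
  have "((K \<star> L) \<star> M) u v = (\<Sum>w\<in>V. \<Sum>x\<in>V. K u x * L x w * M w v)"
    by (simp add: kmul_def sum_distrib_right)
  also have "\<dots> = (\<Sum>x\<in>V. \<Sum>w\<in>V. K u x * L x w * M w v)"
    by (rule sum.swap)
  also have "\<dots> = (K \<star> (L \<star> M)) u v"
    by (simp add: kmul_def sum_distrib_left mult.assoc)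
  finally show "((K \<star> L) \<star> M) u v = (K \<star> (L \<star> M)) u v" .
qed

lemma app_kmul: "app (K \<star> L) f = app K (app L f)"
proof
  fix u
  have "app (K \<star> L) f u = (\<Sum>w\<in>V. \<Sum>x\<in>V. K u x * L x w * f w)"
    by (simp add: app_def kmul_def sum_distrib_right)
  also have "\<dots> = (\<Sum>x\<in>V. \<Sum>w\<in>V. K u x * L x w * f w)"
    by (rule sum.swap)
  also have "\<dots> = app K (app L f) u"
    by (simp add: app_def sum_distrib_left mult.assoc)
  finally show "app (K \<star> L) f u = app K (app L f) u" .
qed

lemma ktrace_kmul_comm: "ktrace (K \<star> L) = ktrace (L \<star> K)"
  unfolding ktrace_def kmul_def by (subst sum.swap) (simp add: mult.commute)

lemma ip_app_right: "ksym K \<Longrightarrow> ip f (app K g) = ip (app K f) g"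
  unfolding ip_def app_def ksym_def sum_distrib_left sum_distrib_right
  by (subst sum.swap) (auto intro!: sum.cong)

lemma ip_self_nonneg: "0 \<le> ip f f"
  by (simp add: ip_def sum_nonneg)

lemma ip_Cauchy_Schwarz: "(ip f g)\<^sup>2 \<le> ip f f * ip g g"
  using Cauchy_Schwarz_ineq_sum[of f g V] by (simp add: ip_def power2_eq_square)

lemma kmul_entry_ip: "ksym K \<Longrightarrow> (K \<star> L) u v = ip (\<lambda>w. K w u) (\<lambda>w. L w v)"
  by (simp add: kmul_def ip_def ksym_def)

lemma kmul_column: "(\<lambda>u. (K \<star> L) u v) = app K (\<lambda>w. L w v)"
  by (simp add: kmul_def app_def)

lemma supported_kpow_0: "supported (kpow K 0)"
  by (auto simp: supported_def)

lemma supported_kmul: "supported K \<Longrightarrow> supported L \<Longrightarrow> supported (K \<star> L)"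
  by (auto simp: supported_def kmul_def intro!: sum.neutral)

lemma supported_kpow: "supported K \<Longrightarrow> supported (kpow K j)"
  by (induction j) (auto simp: supported_kmul supported_kpow_0 simp del: kpow.simps(1))

lemma kpow_0_kmul: "supported L \<Longrightarrow> kpow K 0 \<star> L = L"
proof (intro ext)
  fix u v assume L: "supported L"
  have "(kpow K 0 \<star> L) u v = (\<Sum>w\<in>V. if w = u then L u v else 0)"
    unfolding kmul_def by (intro sum.cong) auto
  also have "\<dots> = L u v"
    using finite_V L by (auto simp: supported_def)
  finally show "(kpow K 0 \<star> L) u v = L u v" .
qed

lemma kmul_kpow_0: "supported L \<Longrightarrow> L \<star> kpow K 0 = L"
proof (intro ext)
  fix u v assume L: "supported L"
  have "(L \<star> kpow K 0) u v = (\<Sum>w\<in>V. if w = v then L u v else 0)"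
    unfolding kmul_def by (intro sum.cong) auto
  also have "\<dots> = L u v"
    using finite_V L by (auto simp: supported_def)
  finally show "(L \<star> kpow K 0) u v = L u v" .
qed

lemma kpow_1: "supported K \<Longrightarrow> kpow K (Suc 0) = K"
  by (simp add: kmul_kpow_0 del: kpow.simps(1))

lemma kpow_add: "supported K \<Longrightarrow> kpow K (i + j) = kpow K i \<star> kpow K j"
  by (induction i) (auto simp: kmul_assoc kpow_0_kmul supported_kpow simp del: kpow.simps(1))

lemma kpow_Suc2: "supported K \<Longrightarrow> kpow K (Suc j) = kpow K j \<star> K"
  using kpow_add[of K j 1] by (simp add: kpow_1 del: kpow.simps)

lemma ksym_kpow:
  assumes "supported K" "ksym K"
  shows "ksym (kpow K j)"
proof (induction j)
  case 0
  then show ?case by (auto simp: ksym_def)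
next
  case (Suc j)
  have "kpow K (Suc j) u v = kpow K (Suc j) v u" for u v
  proof -
    have "kpow K (Suc j) u v = (\<Sum>w\<in>V. K w u * kpow K j v w)"
      using assms Suc by (simp add: kmul_def ksym_def)
    also have "\<dots> = kpow K (Suc j) v u"
      unfolding kpow_Suc2[OF assms(1)] by (simp add: kmul_def mult.commute)
    finally show ?thesis .
  qed
  then show ?case by (simp add: ksym_def)
qed

lemma kmul_mono:
  assumes "\<And>u v. 0 \<le> K u v" "\<And>u v. K u v \<le> K' u v" "\<And>u v. 0 \<le> L u v" "\<And>u v. L u v \<le> L' u v"
  shows "0 \<le> (K \<star> L) u v" "(K \<star> L) u v \<le> (K' \<star> L') u v"
  unfolding kmul_def using assms
  by (auto intro!: sum_nonneg sum_mono mult_mono order_trans[OF assms(1) assms(2)])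

lemma kpow_mono:
  assumes "\<And>u v. 0 \<le> K u v" "\<And>u v. K u v \<le> L u v"
  shows "0 \<le> kpow K j u v" "kpow K j u v \<le> kpow L j u v"
proof (induction j arbitrary: u v)
  case (Suc j)
  { case 1 show ?case using kmul_mono(1)[of K L "kpow K j" "kpow L j"] assms Suc by simp }
  { case 2 show ?case using kmul_mono(2)[of K L "kpow K j" "kpow L j"] assms Suc by simp }
qed auto

lemma ip_kpow_kpow:
  assumes "supported K" "ksym K"
  shows "ip (app (kpow K i) f) (app (kpow K j) f) = ip f (app (kpow K (i + j)) f)"
  using ip_app_right[OF ksym_kpow[OF assms], of f i] by (simp add: kpow_add[OF assms(1)] app_kmul)

lemma kpow_double_diag_eq_ip:
  assumes "supported K" "ksym K"
  shows "kpow K (j + j) v v = ip (\<lambda>u. kpow K j u v) (\<lambda>u. kpow K j u v)"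
  unfolding kpow_add[OF assms(1)] by (rule kmul_entry_ip[OF ksym_kpow[OF assms]])

lemma app_kpow_0: "u \<in> V \<Longrightarrow> app (kpow K 0) f u = f u"
proof -
  assume "u \<in> V"
  then have "app (kpow K 0) f u = (\<Sum>v\<in>V. if v = u then f u else 0)"
    unfolding app_def by (intro sum.cong) auto
  then show ?thesis using finite_V \<open>u \<in> V\<close> by simp
qed

lemma ip_cong: "(\<And>u. u \<in> V \<Longrightarrow> f u = f' u) \<Longrightarrow> (\<And>u. u \<in> V \<Longrightarrow> g u = g' u) \<Longrightarrow> ip f g = ip f' g'"
  by (simp add: ip_def)

text \<open>Cauchy-Schwarz in every row. For symmetric \<open>K\<close> the trace is the squared
  Hilbert-Schmidt norm, which thus bounds the squared operator norm.\<close>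

lemma ip_app_self_le:
  assumes "ksym K"
  shows "ip (app K f) (app K f) \<le> ktrace (K \<star> K) * ip f f"
proof -
  have "ip (app K f) (app K f) = (\<Sum>u\<in>V. (ip (\<lambda>v. K v u) f)\<^sup>2)"
    using assms by (simp add: ip_def app_def power2_eq_square ksym_def)
  also have "\<dots> \<le> (\<Sum>u\<in>V. ip (\<lambda>v. K v u) (\<lambda>v. K v u) * ip f f)"
    by (intro sum_mono ip_Cauchy_Schwarz)
  also have "\<dots> = ktrace (K \<star> K) * ip f f"
    by (simp add: ktrace_def kmul_entry_ip[OF assms] sum_distrib_right)
  finally show ?thesis .
qed

end

section \<open>Log-convex sequences\<close>

text \<open>A zero at any other index forces a zero at the neighbour closer to 1, so positivity at 1
  spreads in both directions.\<close>

lemma log_convex_pos: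
  fixes a :: "nat \<Rightarrow> real"
  assumes "\<And>j. 0 \<le> a j" and lc: "\<And>j. (a (Suc j))\<^sup>2 \<le> a j * a (Suc (Suc j))"
    and "0 < a 1"
  shows "0 < a j"
proof (cases j)
  case 0
  have "a 0 \<noteq> 0" using lc[of 0] assms(3) by auto
  then show ?thesis using assms(1)[of 0] 0 by simp
next
  case (Suc i)
  have "0 < a (Suc i)"
  proof (induction i)
    case (Suc i)
    have "a (Suc (Suc i)) \<noteq> 0" using lc[of i] Suc by auto
    then show ?case using assms(1)[of "Suc (Suc i)"] by simp
  qed (use assms in simp)
  then show ?thesis using Suc by simp
qed

text \<open>The quotients of consecutive terms do not decrease, so each is at least the first one.
  The form without division also covers sequences with vanishing terms.\<close>

lemma log_convex_ratio:
  fixes a :: "nat \<Rightarrow> real"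
  assumes nn: "\<And>j. 0 \<le> a j" and lc: "\<And>j. (a (Suc j))\<^sup>2 \<le> a j * a (Suc (Suc j))"
  shows "a 1 * a j \<le> a 0 * a (Suc j)"
proof (cases "a 1 = 0")
  case True
  then show ?thesis using nn by simp
next
  case False
  then have pos: "0 < a i" for i
    using log_convex_pos[where a = a, OF nn lc] nn[of 1] by simp
  show ?thesis
  proof (induction j)
    case (Suc j)
    have "a 1 * a j * a (Suc j) \<le> a 0 * (a (Suc j))\<^sup>2"
      using mult_right_mono[OF Suc nn[of "Suc j"]] by (simp add: power2_eq_square mult.assoc)
    also have "\<dots> \<le> a 0 * (a j * a (Suc (Suc j)))"
      by (rule mult_left_mono[OF lc nn])
    finally have "a j * (a 1 * a (Suc j)) \<le> a j * (a 0 * a (Suc (Suc j)))"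
      by (simp add: algebra_simps)
    then show ?case using pos[of j] by simp
  qed (simp add: mult.commute)
qed

text \<open>This multiplies the first \<open>j\<close> quotients, each of which is at least
  \<open>a 1 / a 0\<close>.\<close>

lemma log_convex_power:
  fixes a :: "nat \<Rightarrow> real"
  assumes nn: "\<And>j. 0 \<le> a j" and lc: "\<And>j. (a (Suc j))\<^sup>2 \<le> a j * a (Suc (Suc j))"
  shows "a 1 ^ j * a 0 \<le> a j * a 0 ^ j"
proof (induction j)
  case (Suc j)
  have "a 1 ^ Suc j * a 0 = a 1 * (a 1 ^ j * a 0)" by simp
  also have "\<dots> \<le> a 1 * (a j * a 0 ^ j)" by (rule mult_left_mono[OF Suc nn])
  also have "\<dots> = (a 1 * a j) * a 0 ^ j" by simp
  also have "\<dots> \<le> (a 0 * a (Suc j)) * a 0 ^ j"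
    by (rule mult_right_mono[OF log_convex_ratio[where a = a, OF nn lc]]) (simp add: nn)
  finally show ?case by (simp add: mult_ac)
qed simp

section \<open>Operator norm from traces of even powers\<close>

context finite_vertices
begin

text \<open>Cauchy-Schwarz for the images of \<open>f\<close> under the powers \<open>i\<close> and
  \<open>j\<close>, where symmetry collects all factors on one side. Only even moments occur on the
  right; they are squared norms, although \<open>K\<close> need not be positive
  semidefinite.\<close>

lemma log_convex_ip_kpow:
  assumes "supported K" "ksym K"
  shows "(ip f (app (kpow K (i + j)) f))\<^sup>2 \<le> ip f (app (kpow K (i + i)) f) * ip f (app (kpow K (j + j)) f)"
  using ip_Cauchy_Schwarz[of "app (kpow K i) f" "app (kpow K j) f"]
  by (simp only: ip_kpow_kpow[OF assms])

text \<open>Letting \<open>j\<close> tend to infinity removes the factor \<open>c\<close>, because \<open>j \<mapsto> \<parallel>K\<^sup>j f\<parallel>\<^sup>2\<close> is log-convex.\<close>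

lemma operator_norm_from_traces:
  assumes K: "supported K" "ksym K" and l: "0 \<le> l"
    and tr: "\<And>j. ktrace (kpow K (j + j)) \<le> c * l ^ (j + j)"
  shows "ip (app K f) (app K f) \<le> l\<^sup>2 * ip f f"
proof -
  define a where "a j = ip (app (kpow K j) f) (app (kpow K j) f)" for j
  have nn: "0 \<le> a j" for j by (simp add: a_def ip_self_nonneg)
  have lc: "(a (Suc j))\<^sup>2 \<le> a j * a (Suc (Suc j))" for j
    using log_convex_ip_kpow[OF K, of f j "Suc (Suc j)"]
    by (simp add: a_def ip_kpow_kpow[OF K] del: kpow.simps)
  have a0: "a 0 = ip f f"
    unfolding a_def by (rule ip_cong) (simp_all add: app_kpow_0 del: kpow.simps)
  have a1: "a 1 = ip (app K f) (app K f)"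
    by (simp add: a_def kpow_1[OF K(1)] del: kpow.simps)
  have up: "a j \<le> c * l ^ (j + j) * a 0" for j
  proof -
    have "a j \<le> ktrace (kpow K j \<star> kpow K j) * ip f f"
      unfolding a_def by (rule ip_app_self_le[OF ksym_kpow[OF K]])
    also have "\<dots> \<le> c * l ^ (j + j) * ip f f"
      using tr[of j] by (intro mult_right_mono) (simp_all add: kpow_add[OF K(1)] ip_self_nonneg)
    finally show ?thesis by (simp add: a0)
  qed
  have main: "a 1 \<le> l\<^sup>2 * a 0"
  proof (rule ccontr)
    assume "\<not> ?thesis"
    then have gt: "l\<^sup>2 * a 0 < a 1" by simp
    then have a1pos: "0 < a 1"
      using nn[of 0] by (meson le_less_trans mult_nonneg_nonneg zero_le_power2)
    have a0pos: "0 < a 0" using log_convex_pos[where a = a, OF nn lc a1pos] .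
    have pw: "a 1 ^ j \<le> c * (l\<^sup>2 * a 0) ^ j" for j
    proof -
      have "a 1 ^ j * a 0 \<le> a j * a 0 ^ j" by (rule log_convex_power[where a = a, OF nn lc])
      also have "\<dots> \<le> c * l ^ (j + j) * a 0 * a 0 ^ j"
        using up[of j] a0pos by (intro mult_right_mono) auto
      finally have "a 1 ^ j * a 0 \<le> (c * (l\<^sup>2 * a 0) ^ j) * a 0"
        by (simp add: power_mult_distrib power2_eq_square power_add mult_ac)
      then show ?thesis using a0pos by simp
    qed
    \<comment> \<open>Since the quotient of the bases exceeds 1, \<open>a 1 ^ j\<close> eventually
      outgrows the bound \<open>pw\<close>. Forming the quotient requires \<open>l\<close> to be
      nonzero; for \<open>l = 0\<close> the exponent 1 already gives the contradiction.\<close>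
    show False
    proof (cases "l = 0")
      case True
      then show False using pw[of 1] a1pos by simp
    next
      case False
      then have p: "0 < l\<^sup>2 * a 0" using a0pos by simp
      then have "1 < a 1 / (l\<^sup>2 * a 0)" using gt by simp
      then obtain j where "c < (a 1 / (l\<^sup>2 * a 0)) ^ j" using real_arch_pow by blast
      then have "c * (l\<^sup>2 * a 0) ^ j < a 1 ^ j"
        using p by (simp add: power_divide pos_less_divide_eq)
      then show False using pw[of j] by simp
    qed
  qed
  then show ?thesis by (simp only: a0 a1)
qed

end

section \<open>Pseudorandom kernels\<close>

text \<open>The spectrum enters only through traces of even powers: the eigenvalue \<open>d\<close>
  contributes its power once, and every other eigenvalue at most the same power of
  \<open>l\<close>.\<close>

locale pseudorandom = finite_vertices V for V :: "'a set" +
  fixes A :: "'a kernel" and d l :: real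
  assumes V_ne: "V \<noteq> {}"
    and supp_A: "supported A" and sym_A: "ksym A"
    and A_01: "A u v \<in> {0, 1}" and A_diag: "A v v = 0"
    and row_A: "u \<in> V \<Longrightarrow> (\<Sum>v\<in>V. A u v) = d"
    and l_nonneg: "0 \<le> l"
    and trace_A: "j \<ge> 1 \<Longrightarrow> ktrace (kpow A (j + j)) \<le> d ^ (j + j) + real (card V) * l ^ (j + j)"
begin

abbreviation n :: real where "n \<equiv> real (card V)"

text \<open>The orthogonal projection onto the constant functions on \<open>V\<close>. By
  regularity, \<open>d\<close> times it is the part of \<open>A\<close> that acts on
  constants.\<close>

definition J :: "'a kernel" where
  "J u v = (if u \<in> V \<and> v \<in> V then 1 / n else 0)"

definition Q :: "'a kernel" where
  "Q u v = A u v - d * J u v"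

lemma n_pos: "0 < n"
  using finite_V V_ne by (simp add: card_gt_0_iff)

lemma A_nonneg: "0 \<le> A u v"
  using A_01[of u v] by auto

lemma A_le_1: "A u v \<le> 1"
  using A_01[of u v] by auto

lemma d_nonneg: "0 \<le> d"
proof -
  obtain u where "u \<in> V" using V_ne by blast
  then show ?thesis using row_A[of u] by (auto intro!: sum_nonneg A_nonneg simp flip: row_A)
qed

lemma d_le_n: "d \<le> n"
proof -
  obtain u where "u \<in> V" using V_ne by blast
  have "(\<Sum>v\<in>V. A u v) \<le> (\<Sum>v\<in>V. 1)" by (intro sum_mono A_le_1)
  then show ?thesis using row_A[OF \<open>u \<in> V\<close>] by simp
qed

lemma supp_J: "supported J" and sym_J: "ksym J"
  by (auto simp: supported_def ksym_def J_def)

lemma supp_Q: "supported Q" and sym_Q: "ksym Q"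
  using supp_A supp_J sym_A sym_J by (auto simp: supported_def ksym_def Q_def)

lemma A_kmul: "A \<star> K = (\<lambda>u v. (Q \<star> K) u v + d * (J \<star> K) u v)"
  by (auto simp: kmul_def Q_def left_diff_distrib sum_subtractf sum_distrib_left mult.assoc)

lemma kmul_A: "K \<star> A = (\<lambda>u v. (K \<star> Q) u v + d * (K \<star> J) u v)"
  by (auto simp: kmul_def Q_def right_diff_distrib sum_subtractf sum_distrib_left algebra_simps)

lemma A_kmul_J: "A \<star> J = (\<lambda>u v. d * J u v)"
proof (intro ext)
  fix u v
  have "(A \<star> J) u v = (\<Sum>w\<in>V. A u w) * J u v" if "u \<in> V"
    using that by (auto simp: kmul_def J_def sum_distrib_right intro!: sum.cong)
  then show "(A \<star> J) u v = d * J u v"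
    using supported_kmul[OF supp_A supp_J] supp_J
    by (cases "u \<in> V") (auto simp: row_A supported_def)
qed

lemma J_kmul_J: "J \<star> J = J"
proof (intro ext)
  fix u v
  have "(J \<star> J) u v = (\<Sum>w\<in>V. J u v / n)"
    unfolding kmul_def by (intro sum.cong) (auto simp: J_def)
  then show "(J \<star> J) u v = J u v" using n_pos by simp
qed

lemma Q_kmul_J: "Q \<star> J = (\<lambda>u v. 0)"
  using A_kmul[of J] A_kmul_J J_kmul_J by (auto simp: fun_eq_iff)

lemma J_kmul_Q: "J \<star> Q = (\<lambda>u v. 0)"
proof (intro ext)
  fix u v
  have "(J \<star> Q) u v = (Q \<star> J) v u"
    using sym_J sym_Q by (auto simp: kmul_def ksym_def mult.commute)
  then show "(J \<star> Q) u v = 0" by (simp add: Q_kmul_J)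
qed

text \<open>No cross terms survive, because \<open>J\<close> annihilates \<open>Q\<close> and
  \<open>A\<close> multiplies \<open>J\<close> by \<open>d\<close>. The exponent is positive since
  both zeroth powers are the identity.\<close>

lemma kpow_A_eq: "kpow A (Suc j) = (\<lambda>u v. kpow Q (Suc j) u v + d ^ Suc j * J u v)"
proof (induction j)
  case 0
  then show ?case
    unfolding kpow_1[OF supp_A] kpow_1[OF supp_Q] by (auto simp: Q_def)
next
  case (Suc j)
  have "J \<star> kpow Q (Suc j) = (\<lambda>u v. 0)"
    by (simp add: J_kmul_Q flip: kmul_assoc) (simp add: kmul_def)
  then have *: "A \<star> kpow Q (Suc j) = kpow Q (Suc (Suc j))"
    using A_kmul[of "kpow Q (Suc j)"] by simp
  have "kpow A (Suc (Suc j)) = (\<lambda>u v. (A \<star> kpow Q (Suc j)) u v + d ^ Suc j * (A \<star> J) u v)"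
    unfolding kpow.simps(2)[of A "Suc j"] Suc
    by (simp add: kmul_def distrib_left sum.distrib sum_distrib_left mult_ac)
  then show ?case unfolding * A_kmul_J by (simp add: mult_ac)
qed

lemma ktrace_J: "ktrace J = 1"
  using n_pos by (simp add: ktrace_def J_def)

text \<open>For positive \<open>j\<close> the rank-one part has trace \<open>d ^ (j + j)\<close>,
  which cancels the first term of \<open>trace_A\<close>. For \<open>j = 0\<close> the trace is the
  number of vertices.\<close>

lemma trace_Q: "ktrace (kpow Q (j + j)) \<le> n * l ^ (j + j)"
proof (cases j)
  case 0
  then show ?thesis by (simp add: ktrace_def)
next
  case (Suc i)
  have "ktrace (kpow A (Suc p)) = ktrace (kpow Q (Suc p)) + d ^ Suc p" for p
    unfolding kpow_A_eq using ktrace_J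
    by (simp add: ktrace_def sum.distrib del: kpow.simps power_Suc flip: sum_distrib_left)
  from this[of "i + j"] show ?thesis using trace_A[of j] Suc by simp
qed

text \<open>The factor \<open>n\<close> in \<open>trace_Q\<close> is the constant \<open>c\<close>
  that \<open>operator_norm_from_traces\<close> removes.\<close>

lemma Q_norm: "ip (app Q f) (app Q f) \<le> l\<^sup>2 * ip f f"
  by (rule operator_norm_from_traces[OF supp_Q sym_Q l_nonneg trace_Q])

lemma Q_pow_norm: "ip (app (kpow Q j) f) (app (kpow Q j) f) \<le> (l ^ j)\<^sup>2 * ip f f"
proof (induction j)
  case 0
  have "ip (app (kpow Q 0) f) (app (kpow Q 0) f) = ip f f"
    by (rule ip_cong) (simp_all add: app_kpow_0 del: kpow.simps)
  then show ?case by simp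
next
  case (Suc j)
  have "ip (app (kpow Q (Suc j)) f) (app (kpow Q (Suc j)) f)
      \<le> l\<^sup>2 * ip (app (kpow Q j) f) (app (kpow Q j) f)"
    by (simp add: app_kmul Q_norm)
  also have "\<dots> \<le> l\<^sup>2 * ((l ^ j)\<^sup>2 * ip f f)"
    by (intro mult_left_mono Suc) simp
  finally show ?case by (simp add: power_mult_distrib mult.assoc)
qed

lemma Q_pow_form: "\<bar>ip f (app (kpow Q j) f)\<bar> \<le> l ^ j * ip f f"
proof -
  have "(ip f (app (kpow Q j) f))\<^sup>2 \<le> ip f f * ((l ^ j)\<^sup>2 * ip f f)"
    by (rule order_trans[OF ip_Cauchy_Schwarz mult_left_mono[OF Q_pow_norm ip_self_nonneg]])
  also have "\<dots> = (l ^ j * ip f f)\<^sup>2" by (simp add: power2_eq_square mult_ac)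
  finally show ?thesis
    using l_nonneg ip_self_nonneg[of f] by (simp add: abs_le_square_iff[symmetric])
qed

text \<open>The geometric mean from Cauchy-Schwarz is replaced by the arithmetic mean, which makes
  the bound additive and lets it be summed over the columns of a kernel.\<close>

lemma Q_form: "\<bar>ip f (app Q g)\<bar> \<le> l * ((ip f f + ip g g) / 2)"
proof -
  have "(ip f (app Q g))\<^sup>2 \<le> ip f f * (l\<^sup>2 * ip g g)"
    by (rule order_trans[OF ip_Cauchy_Schwarz mult_left_mono[OF Q_norm ip_self_nonneg]])
  also have "\<dots> = l\<^sup>2 * (ip f f * ip g g)" by simp
  also have "\<dots> \<le> l\<^sup>2 * ((ip f f + ip g g) / 2)\<^sup>2"
    using zero_le_power2[of "ip f f - ip g g"]
    by (intro mult_left_mono) (simp_all add: power2_eq_square field_simps)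
  also have "\<dots> = (l * ((ip f f + ip g g) / 2))\<^sup>2" by (simp only: power_mult_distrib)
  finally show ?thesis
    using l_nonneg ip_self_nonneg[of f] ip_self_nonneg[of g]
    by (simp add: abs_le_square_iff[symmetric])
qed

section \<open>Closed walks at a vertex\<close>

lemma kpow_A_two:
  assumes v: "v \<in> V"
  shows "kpow A (Suc (Suc 0)) v v = d"
proof -
  have "kpow A (Suc (Suc 0)) v v = (\<Sum>w\<in>V. A v w * A w v)"
    unfolding kpow.simps(2)[of A "Suc 0"] kpow_1[OF supp_A] by (simp add: kmul_def)
  also have "\<dots> = (\<Sum>w\<in>V. A v w)"
  proof (rule sum.cong)
    fix w show "A v w * A w v = A v w"
      using A_01[of v w] sym_A by (auto simp: ksym_def)
  qed simp
  finally show ?thesis using row_A[OF v] by simp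
qed

text \<open>One factor \<open>Q\<close> is split off at each end, which leaves the quadratic form of
  \<open>kpow Q j\<close> in the column of \<open>Q\<close> at \<open>v\<close>. The squared norm of
  that column is the diagonal entry of the square of \<open>Q\<close>, hence at most
  \<open>d\<close>.\<close>

lemma closed_walks_at_le:
  assumes v: "v \<in> V"
  shows "kpow A (Suc (Suc j)) v v \<le> d ^ Suc (Suc j) / n + l ^ j * d"
proof -
  have QQ: "ip (\<lambda>w. Q w v) (\<lambda>w. Q w v) \<le> d"
  proof -
    have "ip (\<lambda>w. Q w v) (\<lambda>w. Q w v) = kpow Q (Suc (Suc 0)) v v"
      unfolding kpow.simps(2)[of Q "Suc 0"] kpow_1[OF supp_Q] by (simp add: kmul_entry_ip[OF sym_Q])
    also have "\<dots> = d - d\<^sup>2 / n"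
      using kpow_A_two[OF v] v unfolding kpow_A_eq by (simp add: J_def power2_eq_square del: kpow.simps)
    also have "\<dots> \<le> d" using n_pos by simp
    finally show ?thesis .
  qed
  have "kpow Q (Suc (Suc j)) v v = (Q \<star> (kpow Q j \<star> Q)) v v"
    unfolding kpow.simps(2)[of Q "Suc j"] kpow_Suc2[OF supp_Q, of j] ..
  also have "\<dots> = ip (\<lambda>w. Q w v) (app (kpow Q j) (\<lambda>w. Q w v))"
    by (simp add: kmul_entry_ip[OF sym_Q] kmul_column)
  also have "\<dots> \<le> l ^ j * ip (\<lambda>w. Q w v) (\<lambda>w. Q w v)"
    using Q_pow_form[of "\<lambda>w. Q w v" j] by simp
  also have "\<dots> \<le> l ^ j * d"
    using QQ l_nonneg by (intro mult_left_mono) auto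
  finally show ?thesis
    using v unfolding kpow_A_eq by (simp add: J_def del: kpow.simps)
qed

text \<open>Compared with \<open>trace_A\<close>, two factors \<open>l\<close> become one factor
  \<open>d\<close>. After multiplication by \<open>l\<close> the error contains
  \<open>n * l ^ Suc (j + j)\<close>, the quantity bounded by the eigenvalue hypothesis.\<close>

lemma trace_A_even_le:
  "ktrace (kpow A (Suc j + Suc j)) \<le> d ^ (Suc j + Suc j) + n * (l ^ (j + j) * d)"
proof -
  have "ktrace (kpow A (Suc j + Suc j)) \<le> (\<Sum>v\<in>V. d ^ (Suc j + Suc j) / n + l ^ (j + j) * d)"
    unfolding ktrace_def using closed_walks_at_le[of _ "j + j"] by (intro sum_mono) simp
  also have "\<dots> = d ^ (Suc j + Suc j) + n * (l ^ (j + j) * d)"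
    using n_pos by (simp add: distrib_left)
  finally show ?thesis .
qed

end

section \<open>Walks in subgraphs\<close>

locale subkernel = pseudorandom V A d l for V :: "'a set" and A d l +
  fixes B :: "'a kernel"
  assumes sym_B: "ksym B" and B_nonneg: "0 \<le> B u v" and B_le_A: "B u v \<le> A u v"
begin

lemma supp_B: "supported B"
  using supp_A B_nonneg B_le_A unfolding supported_def by (metis order_antisym)

lemma kpow_B_nonneg: "0 \<le> kpow B j u v"
  by (rule kpow_mono(1)[where L = A]) (rule B_nonneg B_le_A)+

lemma kpow_B_le_A: "kpow B j u v \<le> kpow A j u v"
  by (rule kpow_mono(2)) (rule B_nonneg B_le_A)+

lemma ktrace_kmul_J: "ktrace (kpow B j \<star> J) = walks B j / n"
  by (simp add: ktrace_def kmul_def walks_def ip_def app_def J_def sum_divide_distrib)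

text \<open>The trace of \<open>B\<^sup>2\<^sup>p\<^sup>+\<^sup>1 (A - B)\<^sup>2\<close> counts walks, hence is nonnegative; expanding the square
  bounds the odd closed walks of \<open>B\<close> from below by traces with a factor \<open>A\<close>, and these can be
  evaluated since \<open>A \<approx> d J\<close>.\<close>

lemma ktrace_odd_ge_mixed:
  "2 * ktrace (kpow B (Suc p + Suc p) \<star> A) - ktrace (kpow B (Suc p + p) \<star> (A \<star> A))
    \<le> ktrace (kpow B (Suc (Suc p + Suc p)))"
proof -
  let ?X = "kpow B (Suc p + p)"
  define D where "D = (\<lambda>u v. A u v - B u v)"
  have D: "0 \<le> D u v" for u v using B_le_A by (simp add: D_def)
  have DD: "D \<star> D = (\<lambda>u v. (A \<star> A) u v - (A \<star> B) u v - (B \<star> A) u v + (B \<star> B) u v)"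
    by (simp add: D_def kmul_def algebra_simps sum_subtractf sum.distrib fun_eq_iff)
  have "0 \<le> ktrace (?X \<star> (D \<star> D))"
    unfolding ktrace_def kmul_def by (intro sum_nonneg mult_nonneg_nonneg kpow_B_nonneg D)
  also have "ktrace (?X \<star> (D \<star> D)) = ktrace (?X \<star> (A \<star> A)) - ktrace (?X \<star> (A \<star> B))
      - ktrace (?X \<star> (B \<star> A)) + ktrace (?X \<star> (B \<star> B))"
    unfolding DD ktrace_def kmul_def[of ?X]
    by (simp add: distrib_left right_diff_distrib sum.distrib sum_subtractf del: kpow.simps)
  \<comment> \<open>Both mixed terms are the same trace, the second one by cyclicity.\<close>
  also have "ktrace (?X \<star> (B \<star> A)) = ktrace (kpow B (Suc p + Suc p) \<star> A)"
    by (simp add: kpow_Suc2[OF supp_B] kmul_assoc del: kpow.simps)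
  also have "ktrace (?X \<star> (A \<star> B)) = ktrace (kpow B (Suc p + Suc p) \<star> A)"
    using ktrace_kmul_comm[of "?X \<star> A" B] by (simp add: kmul_assoc)
  also have "ktrace (?X \<star> (B \<star> B)) = ktrace (kpow B (Suc (Suc p + Suc p)))"
    by (simp add: kpow_Suc2[OF supp_B] kmul_assoc del: kpow.simps)
  finally show ?thesis by simp
qed

text \<open>The part \<open>d * J\<close> of \<open>A\<close> yields the walk count. The rest is a
  sum of quadratic forms of \<open>Q\<close> in the columns of \<open>kpow B k\<close>, whose
  squared norms add up to a trace that \<open>A\<close> dominates.\<close>

lemma ktrace_even_kmul_A_ge:
  "d * (walks B (k + k) / n) - l * ktrace (kpow A (k + k)) \<le> ktrace (kpow B (k + k) \<star> A)"
proof -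
  let ?Y = "kpow B k"
  have "ktrace (kpow B (k + k) \<star> Q) = ktrace (?Y \<star> (Q \<star> ?Y))"
    using ktrace_kmul_comm[of ?Y "?Y \<star> Q"] by (simp add: kpow_add[OF supp_B] kmul_assoc)
  also have "\<dots> = (\<Sum>v\<in>V. ip (\<lambda>w. ?Y w v) (app Q (\<lambda>w. ?Y w v)))"
    by (simp add: ktrace_def kmul_entry_ip[OF ksym_kpow[OF supp_B sym_B]] kmul_column)
  also have "\<dots> \<ge> (\<Sum>v\<in>V. - (l * kpow A (k + k) v v))"
  proof (rule sum_mono)
    fix v
    have "l * kpow B (k + k) v v \<le> l * kpow A (k + k) v v"
      by (intro mult_left_mono kpow_B_le_A l_nonneg)
    moreover have "\<bar>ip (\<lambda>w. ?Y w v) (app Q (\<lambda>w. ?Y w v))\<bar> \<le> l * kpow B (k + k) v v"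
      using Q_form[of "\<lambda>w. ?Y w v" "\<lambda>w. ?Y w v"] kpow_double_diag_eq_ip[OF supp_B sym_B, of k v] by simp
    ultimately show "- (l * kpow A (k + k) v v) \<le> ip (\<lambda>w. ?Y w v) (app Q (\<lambda>w. ?Y w v))"
      by linarith
  qed
  finally have "- l * ktrace (kpow A (k + k)) \<le> ktrace (kpow B (k + k) \<star> Q)"
    by (simp add: ktrace_def sum_distrib_left sum_negf)
  moreover have "ktrace (kpow B (k + k) \<star> A) = ktrace (kpow B (k + k) \<star> Q) + d * (walks B (k + k) / n)"
    unfolding kmul_A ktrace_kmul_J[symmetric] by (simp add: ktrace_def sum.distrib sum_distrib_left)
  ultimately show ?thesis by simp
qed

text \<open>An odd power has no symmetric splitting, so one factor \<open>A\<close> is joined to the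
  shorter half. This gives a bilinear form of \<open>Q\<close> in the columns of
  \<open>A \<star> kpow B p\<close> and \<open>kpow B (Suc p)\<close>, both dominated entrywise by
  \<open>kpow A (Suc p)\<close>. The other factor \<open>A\<close> is the one split into
  \<open>Q\<close> and \<open>d * J\<close>.\<close>

lemma ktrace_odd_kmul_A_A_le:
  "ktrace (kpow B (Suc p + p) \<star> (A \<star> A))
    \<le> d\<^sup>2 * (walks B (Suc p + p) / n) + l * ktrace (kpow A (Suc p + Suc p))"
proof -
  let ?Y = "kpow B (Suc p)" and ?Z = "kpow B p"
  have average_le: "x \<le> z \<Longrightarrow> y \<le> z \<Longrightarrow> (x + y) / 2 \<le> z" for x y z :: real
    by simp
  have ZA: "(?Z \<star> A) v w = (A \<star> ?Z) w v" for v w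
    using ksym_kpow[OF supp_B sym_B] sym_A by (simp add: kmul_def ksym_def mult.commute)
  have AZ_le: "0 \<le> (A \<star> ?Z) u v \<and> (A \<star> ?Z) u v \<le> kpow A (Suc p) u v" for u v
    using kmul_mono[of A A ?Z "kpow A p" u v] A_nonneg kpow_B_nonneg kpow_B_le_A by simp
  have "ktrace (kpow B (Suc p + p) \<star> (A \<star> A)) = ktrace ((?Z \<star> A) \<star> (A \<star> ?Y))"
    using ktrace_kmul_comm[of ?Y "(?Z \<star> A) \<star> A"] by (simp only: kpow_add[OF supp_B] kmul_assoc)
  also have "\<dots> = ktrace ((?Z \<star> A) \<star> (Q \<star> ?Y)) + d * ktrace ((?Z \<star> A) \<star> (J \<star> ?Y))"
    unfolding A_kmul[of ?Y] kmul_def[of "?Z \<star> A"]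
    by (simp add: ktrace_def distrib_left sum.distrib sum_distrib_left mult_ac del: kpow.simps)
  also have "ktrace ((?Z \<star> A) \<star> (J \<star> ?Y)) = ktrace (kpow B (Suc p + p) \<star> (A \<star> J))"
    using ktrace_kmul_comm[of ?Y "(?Z \<star> A) \<star> J"] by (simp only: kpow_add[OF supp_B] kmul_assoc)
  also have "\<dots> = d * ktrace (kpow B (Suc p + p) \<star> J)"
    unfolding A_kmul_J ktrace_def kmul_def[of "kpow B (Suc p + p)"]
    by (simp add: sum_distrib_left mult_ac del: kpow.simps)
  also have "ktrace (kpow B (Suc p + p) \<star> J) = walks B (Suc p + p) / n"
    by (rule ktrace_kmul_J)
  finally have split: "ktrace (kpow B (Suc p + p) \<star> (A \<star> A))
      = ktrace ((?Z \<star> A) \<star> (Q \<star> ?Y)) + d * (d * (walks B (Suc p + p) / n))" .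
  have "ktrace ((?Z \<star> A) \<star> (Q \<star> ?Y)) = (\<Sum>v\<in>V. ip (\<lambda>w. (A \<star> ?Z) w v) (app Q (\<lambda>w. ?Y w v)))"
    by (simp add: ktrace_def kmul_def[of "?Z \<star> A"] ZA ip_def flip: kmul_column del: kpow.simps)
  also have "\<dots> \<le> (\<Sum>v\<in>V. l * kpow A (Suc p + Suc p) v v)"
  proof (rule sum_mono)
    fix v
    have "ip (\<lambda>w. (A \<star> ?Z) w v) (\<lambda>w. (A \<star> ?Z) w v) \<le> kpow A (Suc p + Suc p) v v"
      unfolding kpow_double_diag_eq_ip[OF supp_A sym_A] ip_def
      using AZ_le by (intro sum_mono mult_mono) (auto intro: order_trans)
    moreover have "ip (\<lambda>w. ?Y w v) (\<lambda>w. ?Y w v) \<le> kpow A (Suc p + Suc p) v v"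
      unfolding kpow_double_diag_eq_ip[OF supp_B sym_B, symmetric] by (rule kpow_B_le_A)
    ultimately have "(ip (\<lambda>w. (A \<star> ?Z) w v) (\<lambda>w. (A \<star> ?Z) w v) + ip (\<lambda>w. ?Y w v) (\<lambda>w. ?Y w v)) / 2
        \<le> kpow A (Suc p + Suc p) v v"
      by (rule average_le)
    then show "ip (\<lambda>w. (A \<star> ?Z) w v) (app Q (\<lambda>w. ?Y w v)) \<le> l * kpow A (Suc p + Suc p) v v"
      using Q_form[of "\<lambda>w. (A \<star> ?Z) w v" "\<lambda>w. ?Y w v"] l_nonneg
      by (meson abs_le_D1 mult_left_mono order_trans)
  qed
  also have "\<dots> = l * ktrace (kpow A (Suc p + Suc p))"
    by (simp add: ktrace_def sum_distrib_left)
  finally show ?thesis unfolding split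
    by (simp add: power2_eq_square mult.assoc del: kpow.simps add_Suc add_Suc_right)
qed

section \<open>Growth of walk counts\<close>

lemma walks_nonneg: "0 \<le> walks B j"
  by (simp add: walks_def ip_def app_def sum_nonneg kpow_B_nonneg)

lemma walks_Suc_le: "walks B (Suc j) \<le> d * walks B j"
proof -
  have "walks B (Suc j) = ip (app B (\<lambda>_. 1)) (app (kpow B j) (\<lambda>_. 1))"
    by (simp add: walks_def app_kmul ip_app_right[OF sym_B])
  also have "\<dots> \<le> (\<Sum>v\<in>V. d * app (kpow B j) (\<lambda>_. 1) v)"
    unfolding ip_def
  proof (intro sum_mono mult_right_mono)
    fix v assume "v \<in> V"
    have "app B (\<lambda>_. 1) v \<le> (\<Sum>w\<in>V. A v w)"
      unfolding app_def by (auto intro!: sum_mono B_le_A)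
    then show "app B (\<lambda>_. 1) v \<le> d" using row_A[OF \<open>v \<in> V\<close>] by simp
    show "0 \<le> app (kpow B j) (\<lambda>_. 1) v"
      by (simp add: app_def sum_nonneg kpow_B_nonneg)
  qed
  finally show ?thesis by (simp add: walks_def ip_def sum_distrib_left)
qed

lemma walks_0: "walks B 0 = n"
  unfolding walks_def ip_def by (simp add: app_kpow_0 del: kpow.simps)

lemma walks_log_convex: "(walks B (i + j))\<^sup>2 \<le> walks B (i + i) * walks B (j + j)"
  unfolding walks_def by (rule log_convex_ip_kpow[OF supp_B sym_B])

lemma walks_even_log_convex:
  "(walks B (Suc j + Suc j))\<^sup>2 \<le> walks B (j + j) * walks B (Suc (Suc j) + Suc (Suc j))"
  using walks_log_convex[of j "Suc (Suc j)"] by simp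

lemma walks_even_ratio: "walks B 2 * walks B (j + j) \<le> n * walks B (Suc j + Suc j)"
  using log_convex_ratio[where a = "\<lambda>j. walks B (j + j)", OF walks_nonneg walks_even_log_convex, of j]
    walks_0 by (simp add: numeral_2_eq_2)

lemma walks_one_sq_le: "(walks B 1)\<^sup>2 \<le> n * walks B 2"
  using walks_log_convex[of 0 1] walks_0 by (simp add: numeral_2_eq_2)

text \<open>Odd moments are bounded only through even ones, so the inequality is proved after
  squaring: each of the two odd counts is estimated by its even neighbours, and the even ratio bound
  combines the results.\<close>

lemma walks_one_mult_odd_le: "walks B 1 * walks B (Suc p + p) \<le> n * walks B (Suc p + Suc p)"
proof (rule power2_le_imp_le)
  let ?w = "walks B"
  have "(?w 1 * ?w (Suc p + p))\<^sup>2 = (?w 1)\<^sup>2 * (?w (Suc p + p))\<^sup>2" by (rule power_mult_distrib)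
  also have "\<dots> \<le> (n * ?w 2) * (?w (Suc p + Suc p) * ?w (p + p))"
    by (intro mult_mono walks_one_sq_le walks_log_convex mult_nonneg_nonneg walks_nonneg) auto
  also have "\<dots> = n * ?w (Suc p + Suc p) * (?w 2 * ?w (p + p))" by (simp add: mult_ac)
  also have "\<dots> \<le> n * ?w (Suc p + Suc p) * (n * ?w (Suc p + Suc p))"
    by (intro mult_left_mono walks_even_ratio mult_nonneg_nonneg walks_nonneg) auto
  finally show "(?w 1 * ?w (Suc p + p))\<^sup>2 \<le> (n * ?w (Suc p + Suc p))\<^sup>2"
    by (simp add: power2_eq_square)
  show "0 \<le> n * ?w (Suc p + Suc p)" by (simp add: walks_nonneg)
qed

text \<open>Here \<open>walks B 1 / n\<close> is the average degree; its square is at most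
  \<open>walks B 2 / n\<close>, and the even walk counts form a log-convex sequence.\<close>

lemma walks_even_ge: "n * (walks B 1 / n) ^ (k + k) \<le> walks B (k + k)"
proof -
  have "(walks B 1 / n) ^ (k + k) = ((walks B 1)\<^sup>2 / (n * n)) ^ k"
    by (simp add: power_add power_divide power_mult_distrib power2_eq_square)
  also have "\<dots> \<le> (walks B 2 / n) ^ k"
    using walks_one_sq_le n_pos by (intro power_mono) (auto simp: field_simps)
  finally have "n * (walks B 1 / n) ^ (k + k) \<le> n * (walks B 2 / n) ^ k"
    by (intro mult_left_mono) auto
  also have "\<dots> \<le> walks B (k + k)"
    using log_convex_power[where a = "\<lambda>j. walks B (j + j)", OF walks_nonneg walks_even_log_convex, of k]
      walks_0 n_pos by (simp add: numeral_2_eq_2 field_simps)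
  finally show ?thesis .
qed

text \<open>The coefficient 3 collects two errors from the doubled trace with one factor
  \<open>A\<close> and one from the trace with two. The main term is at least
  \<open>\<delta> * d / n\<close> times \<open>d * ?o\<close>, and \<open>d * ?o\<close> is bounded
  below by the walk count at average degree \<open>d / 2\<close>, which produces the power of
  4.\<close>

theorem odd_closed_walks_ge:
  assumes w1: "(1 + \<delta>) / 2 * d * n \<le> walks B 1" and \<delta>: "0 \<le> \<delta>"
  shows "\<delta> * d ^ Suc (Suc p + Suc p) / 4 ^ Suc p - 3 * (l * ktrace (kpow A (Suc p + Suc p)))
    \<le> ktrace (kpow B (Suc (Suc p + Suc p)))"
proof -
  let ?w = "walks B"
  let ?e = "?w (Suc p + Suc p)" and ?o = "?w (Suc p + p)"
  have "((1 + \<delta>) / 2 * d * n) * ?o \<le> ?w 1 * ?o"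
    by (intro mult_right_mono w1 walks_nonneg)
  also have "\<dots> \<le> n * ?e" by (rule walks_one_mult_odd_le)
  finally have "n * ((1 + \<delta>) / 2 * d * ?o) \<le> n * ?e" by (simp add: mult_ac)
  then have o: "(1 + \<delta>) / 2 * d * ?o \<le> ?e" using n_pos by simp
  have "d / 2 \<le> ?w 1 / n"
  proof -
    have "d / 2 * n \<le> (1 + \<delta>) / 2 * d * n"
      using d_nonneg \<delta> n_pos by (simp add: field_simps)
    then show ?thesis using w1 n_pos by (simp add: pos_le_divide_eq)
  qed
  then have "n * (d / 2) ^ (Suc p + Suc p) \<le> n * (?w 1 / n) ^ (Suc p + Suc p)"
    using d_nonneg by (intro mult_left_mono power_mono) auto
  also have "\<dots> \<le> ?e" by (rule walks_even_ge)
  also have "?e \<le> d * ?o" using walks_Suc_le[of "Suc p + p"] by simp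
  finally have "(\<delta> * d / n) * (n * (d / 2) ^ (Suc p + Suc p)) \<le> (\<delta> * d / n) * (d * ?o)"
    using \<delta> d_nonneg n_pos by (intro mult_left_mono) auto
  also have "(\<delta> * d / n) * (n * (d / 2) ^ (Suc p + Suc p)) = \<delta> * d ^ Suc (Suc p + Suc p) / 4 ^ Suc p"
    using n_pos by (simp add: power_divide power_add) (simp flip: power_mult_distrib)
  also have "(\<delta> * d / n) * (d * ?o) = 2 * d / n * ((1 + \<delta>) / 2 * d * ?o) - d\<^sup>2 * (?o / n)"
    using n_pos by (simp add: field_simps power2_eq_square)
  also have "\<dots> \<le> 2 * d / n * ?e - d\<^sup>2 * (?o / n)"
    using o d_nonneg n_pos by (intro diff_right_mono mult_left_mono) auto
  also have "2 * d / n * ?e = 2 * (d * (?e / n))" by simp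
  finally show ?thesis
    using ktrace_odd_ge_mixed[of p] ktrace_even_kmul_A_ge[of "Suc p"] ktrace_odd_kmul_A_A_le[of p]
    by linarith
qed

end

section \<open>Closed walks as lists\<close>

fun path_weight :: "'a kernel \<Rightarrow> 'a list \<Rightarrow> real" where
  "path_weight K (x # y # zs) = K x y * path_weight K (y # zs)"
| "path_weight K _ = 1"

definition cycle_weight :: "'a kernel \<Rightarrow> 'a list \<Rightarrow> real" where
  "cycle_weight K xs = path_weight K (xs @ [hd xs])"

lemma path_weight_append: "path_weight K (xs @ v # ys) = path_weight K (xs @ [v]) * path_weight K (v # ys)"
proof (induction xs)
  case (Cons x xs)
  then show ?case by (cases xs) auto
qed simp

lemma path_weight_nonneg: "(\<And>u v. 0 \<le> K u v) \<Longrightarrow> 0 \<le> path_weight K xs"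
  by (induction K xs rule: path_weight.induct) auto

lemma path_weight_mono:
  "(\<And>u v. 0 \<le> K u v) \<Longrightarrow> (\<And>u v. K u v \<le> L u v) \<Longrightarrow> path_weight K xs \<le> path_weight L xs"
proof (induction K xs rule: path_weight.induct)
  case (1 K x y zs)
  then show ?case
    by (auto intro!: mult_mono path_weight_nonneg intro: order_trans[OF 1(2) 1(3)])
qed auto

lemma path_weight_nonzero_nth:
  "path_weight K xs \<noteq> 0 \<Longrightarrow> Suc i < length xs \<Longrightarrow> K (xs ! i) (xs ! Suc i) \<noteq> 0"
proof (induction K xs arbitrary: i rule: path_weight.induct)
  case (1 K x y zs)
  then show ?case by (cases i) auto
qed auto

text \<open>Cutting at the two occurrences of \<open>v\<close> leaves two closed walks from
  \<open>v\<close>; the second passes through \<open>cs\<close> and wraps around into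
  \<open>as\<close>.\<close>

lemma cycle_weight_split:
  "cycle_weight K (as @ v # bs @ v # cs) = path_weight K (v # bs @ [v]) * path_weight K (v # (cs @ as) @ [v])"
proof (cases as)
  case Nil
  then show ?thesis
    using path_weight_append[of K "v # bs" v "cs @ [v]"] by (simp add: cycle_weight_def)
next
  case (Cons x as')
  have "cycle_weight K (as @ v # bs @ v # cs) = path_weight K (as @ v # bs @ v # cs @ [x])"
    by (simp add: cycle_weight_def Cons)
  also have "\<dots> = path_weight K (as @ [v]) * (path_weight K (v # bs @ [v]) * path_weight K (v # cs @ [x]))"
    using path_weight_append[of K as v "bs @ v # cs @ [x]"]
      path_weight_append[of K "v # bs" v "cs @ [x]"] by simp
  also have "\<dots> = path_weight K (v # bs @ [v]) * path_weight K (v # (cs @ as) @ [v])"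
    using path_weight_append[of K "v # cs" x "as' @ [v]"] by (simp add: Cons)
  finally show ?thesis .
qed

section \<open>Sums over vertex lists and splitting at a repeated vertex\<close>

context finite_vertices
begin

definition lists_of :: "nat \<Rightarrow> 'a list set" where
  "lists_of j = {xs. set xs \<subseteq> V \<and> length xs = j}"

lemma finite_lists_of: "finite (lists_of j)"
  unfolding lists_of_def by (rule finite_lists_length_eq[OF finite_V])

lemma lists_of_0: "lists_of 0 = {[]}"
  by (auto simp: lists_of_def)

lemma sum_lists_of_Suc: "(\<Sum>xs\<in>lists_of (Suc j). f xs) = (\<Sum>v\<in>V. \<Sum>xs\<in>lists_of j. f (v # xs))"
  unfolding sum.cartesian_product
  by (rule sum.reindex_bij_witness[where i = "\<lambda>(v, xs). v # xs" and j = "\<lambda>xs. (hd xs, tl xs)"])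
     (auto simp: lists_of_def length_Suc_conv)

lemma sum_lists_of_add:
  "(\<Sum>xs\<in>lists_of i. \<Sum>ys\<in>lists_of j. f (xs @ ys)) = (\<Sum>zs\<in>lists_of (i + j). f zs)"
  unfolding sum.cartesian_product
  by (rule sum.reindex_bij_witness[where i = "\<lambda>zs. (take i zs, drop i zs)" and j = "\<lambda>(xs, ys). xs @ ys"])
     (auto simp: lists_of_def dest: in_set_takeD in_set_dropD)

lemma kpow_eq_sum_paths:
  assumes K: "supported K"
  shows "kpow K (Suc j) u v = (\<Sum>xs\<in>lists_of j. path_weight K (u # xs @ [v]))"
proof (induction j arbitrary: u)
  case 0
  then show ?case by (simp add: lists_of_0 kpow_1[OF K] del: kpow.simps)
next
  case (Suc j)
  have "kpow K (Suc (Suc j)) u v = (\<Sum>w\<in>V. K u w * kpow K (Suc j) w v)"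
    by (simp add: kmul_def)
  also have "\<dots> = (\<Sum>w\<in>V. \<Sum>xs\<in>lists_of j. path_weight K (u # (w # xs) @ [v]))"
    unfolding Suc by (simp add: sum_distrib_left)
  finally show ?case by (simp only: sum_lists_of_Suc)
qed

lemma ktrace_eq_sum_cycles:
  assumes "supported K"
  shows "ktrace (kpow K (Suc j)) = (\<Sum>xs\<in>lists_of (Suc j). cycle_weight K xs)"
  unfolding ktrace_def kpow_eq_sum_paths[OF assms] sum_lists_of_Suc by (simp add: cycle_weight_def)

text \<open>Here \<open>a\<close> vertices precede one occurrence of a repeated vertex
  \<open>v\<close>, and \<open>b\<close> lie between it and another. Only an inequality holds, since
  a list may admit several such decompositions.\<close>

lemma degenerate_cycles_le:
  assumes K: "supported K" and nn: "\<And>u v. 0 \<le> K u v"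
  shows "(\<Sum>xs | xs \<in> lists_of m \<and> \<not> distinct xs. cycle_weight K xs)
    \<le> (\<Sum>(a, b) | a + b + 2 \<le> m. \<Sum>v\<in>V. kpow K (Suc b) v v * kpow K (m - Suc b) v v)"
proof -
  define S where "S = {(a, b). a + b + 2 \<le> m}"
  have finS: "finite S"
    by (rule finite_subset[of _ "{..m} \<times> {..m}"]) (auto simp: S_def)
  define T where "T = Sigma S (\<lambda>(a, b). V \<times> lists_of b \<times> lists_of (m - 2 - a - b) \<times> lists_of a)"
  define G where "G = (\<lambda>(ab :: nat \<times> nat, v, bs, cs, as). as @ v # bs @ v # cs :: 'a list)"
  let ?N = "{xs \<in> lists_of m. \<not> distinct xs}"
  have finT: "finite T"
    unfolding T_def using finS finite_V finite_lists_of by (intro finite_SigmaI) auto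
  have sub: "?N \<subseteq> G ` T"
  proof
    fix xs assume xs: "xs \<in> ?N"
    then obtain as bs cs v where e: "xs = as @ [v] @ bs @ [v] @ cs"
      using not_distinct_decomp[of xs] by blast
    have "((length as, length bs), v, bs, cs, as) \<in> T"
      using xs by (auto simp: e T_def S_def lists_of_def)
    then show "xs \<in> G ` T"
      by (rule rev_image_eqI) (simp add: G_def e)
  qed
  have cw: "0 \<le> cycle_weight K xs" for xs
    unfolding cycle_weight_def by (rule path_weight_nonneg[OF nn])
  have "(\<Sum>xs\<in>?N. cycle_weight K xs) \<le> (\<Sum>xs\<in>G ` T. cycle_weight K xs)"
    using finT sub by (intro sum_mono2) (auto simp: cw)
  also have "\<dots> \<le> (\<Sum>t\<in>T. cycle_weight K (G t))"
    using sum_image_le[OF finT, of "cycle_weight K" G] cw by (simp add: comp_def)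
  also have "\<dots> = (\<Sum>ab\<in>S. \<Sum>(v, bs, cs, as)\<in>(case ab of (a, b) \<Rightarrow> V \<times> lists_of b \<times> lists_of (m - 2 - a - b) \<times> lists_of a).
      cycle_weight K (as @ v # bs @ v # cs))"
    unfolding T_def using finS finite_V finite_lists_of
    by (subst sum.Sigma) (auto simp: G_def intro!: sum.cong)
  also have "\<dots> = (\<Sum>(a, b)\<in>S. \<Sum>v\<in>V. kpow K (Suc b) v v * kpow K (m - Suc b) v v)"
  proof (rule sum.cong)
    fix ab assume "ab \<in> S"
    then obtain a b where ab: "ab = (a, b)" "a + b + 2 \<le> m" by (auto simp: S_def)
    \<comment> \<open>The second closed walk has \<open>m - 2 - a - b\<close> inner vertices from
      \<open>cs\<close> and \<open>a\<close> from \<open>as\<close>, and one more edge than inner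
      vertices.\<close>
    then have c: "Suc (m - 2 - a - b + a) = m - Suc b" by simp
    have "(\<Sum>(v, bs, cs, as)\<in>V \<times> lists_of b \<times> lists_of (m - 2 - a - b) \<times> lists_of a.
        cycle_weight K (as @ v # bs @ v # cs))
      = (\<Sum>v\<in>V. \<Sum>bs\<in>lists_of b. path_weight K (v # bs @ [v])
          * (\<Sum>cs\<in>lists_of (m - 2 - a - b). \<Sum>as\<in>lists_of a. path_weight K (v # (cs @ as) @ [v])))"
      by (simp add: cycle_weight_split sum_distrib_left flip: sum.cartesian_product)
    also have "\<dots> = (\<Sum>v\<in>V. \<Sum>bs\<in>lists_of b. path_weight K (v # bs @ [v]) * kpow K (m - Suc b) v v)"
      unfolding c[symmetric] kpow_eq_sum_paths[OF K]
        sum_lists_of_add[where f = "\<lambda>zs. path_weight K (_ # zs @ [_])"] ..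
    also have "\<dots> = (\<Sum>v\<in>V. kpow K (Suc b) v v * kpow K (m - Suc b) v v)"
      unfolding kpow_eq_sum_paths[OF K, of b] by (simp add: sum_distrib_right)
    finally show "(\<Sum>(v, bs, cs, as)\<in>(case ab of (a, b) \<Rightarrow> V \<times> lists_of b \<times> lists_of (m - 2 - a - b) \<times> lists_of a).
        cycle_weight K (as @ v # bs @ v # cs)) = (case ab of (a, b) \<Rightarrow> \<Sum>v\<in>V. kpow K (Suc b) v v * kpow K (m - Suc b) v v)"
      by (simp add: ab)
  qed simp
  finally show ?thesis by (simp add: S_def)
qed

end

section \<open>Degenerate closed walks are few\<close>

context pseudorandom
begin

text \<open>A length of 1 gives zero because the diagonal vanishes. Otherwise the pointwise bounds
  are multiplied out: the mixed products are at most \<open>d ^ (m - 1)\<close> since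
  \<open>l \<le> d\<close>, and \<open>X\<close> stands for the product of the two error terms,
  which occurs only if \<open>m\<close> is at least 4.\<close>

lemma closed_walk_pairs_le:
  assumes ld: "l \<le> d" and X: "0 \<le> X" "4 \<le> m \<Longrightarrow> n * l ^ (m - 4) * d\<^sup>2 \<le> X"
    and st: "s + t = m" "1 \<le> s" "1 \<le> t"
  shows "(\<Sum>v\<in>V. kpow A s v v * kpow A t v v) \<le> d ^ m / n + 2 * d ^ (m - 1) + X"
    (is "?L \<le> ?R")
proof -
  have R: "0 \<le> ?R" using d_nonneg X by simp
  have "kpow A 1 v v = 0" for v
    using A_diag kpow_1[OF supp_A] by simp
  then have z: "?L \<le> ?R" if "s = 1 \<or> t = 1" using that R by auto
  show ?thesis
  proof (cases "s = 1 \<or> t = 1")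
    case True
    then show ?thesis by (rule z)
  next
    case False
    define i j where "i = s - 2" and "j = t - 2"
    have s: "s = Suc (Suc i)" and t: "t = Suc (Suc j)" using False st by (auto simp: i_def j_def)
    have nn: "0 \<le> kpow A p u v" for p u v
      using kpow_mono(1)[of A A] A_nonneg by simp
    have "?L \<le> (\<Sum>v\<in>V. (d ^ s / n + l ^ i * d) * (d ^ t / n + l ^ j * d))"
      unfolding s t using d_nonneg l_nonneg
      by (intro sum_mono mult_mono closed_walks_at_le nn add_nonneg_nonneg) auto
    also have "\<dots> = n * ((d ^ s / n + l ^ i * d) * (d ^ t / n + l ^ j * d))" by simp
    also have "\<dots> = d ^ s * d ^ t / n + d ^ s * (l ^ j * d) + d ^ t * (l ^ i * d) + n * (l ^ i * l ^ j) * d\<^sup>2"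
      using n_pos by (simp add: field_simps power2_eq_square)
    also have "\<dots> \<le> d ^ s * d ^ t / n + d ^ s * (d ^ j * d) + d ^ t * (d ^ i * d) + n * (l ^ i * l ^ j) * d\<^sup>2"
      using d_nonneg l_nonneg ld by (intro add_mono mult_left_mono mult_right_mono power_mono) auto
    also have "\<dots> = d ^ m / n + 2 * d ^ (m - 1) + n * l ^ (m - 4) * d\<^sup>2"
      unfolding st(1)[symmetric] s t by (simp add: power_add mult_ac)
    also have "\<dots> \<le> ?R"
      using X(2) s t st(1) by simp
    finally show ?thesis .
  qed
qed

end

context subkernel
begin

text \<open>Lists with a repetition cannot account for the whole trace: there are at most
  \<open>m * m\<close> pairs of splitting positions, each contributing at most the bound of
  \<open>closed_walk_pairs_le\<close>.\<close>

lemma ex_distinct_cycle: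
  assumes ld: "l \<le> d" and m: "1 \<le> m"
    and X: "0 \<le> X" "4 \<le> m \<Longrightarrow> n * l ^ (m - 4) * d\<^sup>2 \<le> X"
    and big: "(real m)\<^sup>2 * (d ^ m / n + 2 * d ^ (m - 1) + X) < ktrace (kpow B m)"
  obtains xs where "distinct xs" "set xs \<subseteq> V" "length xs = m" "cycle_weight B xs \<noteq> 0"
proof -
  let ?M = "d ^ m / n + 2 * d ^ (m - 1) + X"
  have M: "0 \<le> ?M" using d_nonneg X by simp
  have "(\<Sum>xs | xs \<in> lists_of m \<and> \<not> distinct xs. cycle_weight B xs)
      \<le> (\<Sum>xs | xs \<in> lists_of m \<and> \<not> distinct xs. cycle_weight A xs)"
    unfolding cycle_weight_def by (intro sum_mono path_weight_mono B_nonneg B_le_A)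
  also have "\<dots> \<le> (\<Sum>(a, b) | a + b + 2 \<le> m. \<Sum>v\<in>V. kpow A (Suc b) v v * kpow A (m - Suc b) v v)"
    by (rule degenerate_cycles_le[OF supp_A A_nonneg])
  also have "\<dots> \<le> (\<Sum>(a, b) | a + b + 2 \<le> m. ?M)"
  proof (rule sum_mono, clarify)
    fix a b :: nat assume "a + b + 2 \<le> m"
    then show "(\<Sum>v\<in>V. kpow A (Suc b) v v * kpow A (m - Suc b) v v) \<le> ?M"
      by (intro closed_walk_pairs_le[OF ld X]) auto
  qed
  also have "\<dots> \<le> (\<Sum>(a, b)\<in>{..<m} \<times> {..<m}. ?M)"
    by (rule sum_mono2) (use M in auto)
  also have "\<dots> = (real m)\<^sup>2 * ?M"
    by (simp add: power2_eq_square split_def)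
  finally have deg: "(\<Sum>xs | xs \<in> lists_of m \<and> \<not> distinct xs. cycle_weight B xs) \<le> (real m)\<^sup>2 * ?M" .
  have "ktrace (kpow B m) = (\<Sum>xs\<in>lists_of m. cycle_weight B xs)"
    using m ktrace_eq_sum_cycles[OF supp_B, of "m - 1"] by (simp del: kpow.simps)
  also have "\<dots> = (\<Sum>xs | xs \<in> lists_of m \<and> distinct xs. cycle_weight B xs)
      + (\<Sum>xs | xs \<in> lists_of m \<and> \<not> distinct xs. cycle_weight B xs)"
    by (subst sum.union_disjoint[symmetric]) (auto simp: finite_lists_of intro!: sum.cong)
  finally have "(\<Sum>xs | xs \<in> lists_of m \<and> distinct xs. cycle_weight B xs) \<noteq> 0"
    using deg big by linarith
  then obtain xs where "xs \<in> lists_of m" "distinct xs" "cycle_weight B xs \<noteq> 0"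
    using sum.not_neutral_contains_not_neutral by force
  then show thesis using that by (auto simp: lists_of_def)
qed

end

section \<open>Lower bounds on eigenvalue bound and degree in the sparse range\<close>

context pseudorandom
begin

text \<open>The square of \<open>Q\<close> has trace \<open>n * (d - d\<^sup>2 / n)\<close> and by
  \<open>trace_Q\<close> at most \<open>n * l\<^sup>2\<close>.\<close>

lemma sparse_l_lower:
  assumes "d \<le> n / 2"
  shows "d / 2 \<le> l\<^sup>2"
proof -
  have two: "kpow Q (1 + 1) v v = d - d\<^sup>2 / n" if v: "v \<in> V" for v
    using kpow_A_two[OF v] v unfolding kpow_A_eq
    by (simp add: J_def power2_eq_square del: kpow.simps)
  have "n * (d - d\<^sup>2 / n) \<le> n * l\<^sup>2"
    using trace_Q[of 1] two by (simp add: ktrace_def power2_eq_square del: kpow.simps)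
  then have "d - d * (d / n) \<le> l\<^sup>2" using n_pos by (simp add: power2_eq_square)
  moreover have "d * (d / n) \<le> d * (1 / 2)"
    using assms d_nonneg n_pos by (intro mult_left_mono) (auto simp: field_simps)
  ultimately show ?thesis by simp
qed

text \<open>The lower bound on \<open>l\<close> confronts the assumed upper bound. Once a power of
  \<open>d\<close> is cancelled, the degree is forced to grow with \<open>n\<close>.\<close>

lemma sparse_degree_lower:
  assumes dn: "d \<le> n / 2" and d1: "1 \<le> d" and l: "l ^ Suc (p + p) \<le> d ^ (Suc p + Suc p) / n"
  shows "n\<^sup>2 \<le> (2 * d) ^ Suc (Suc p + Suc p)"
proof -
  have "(d / 2) ^ Suc (p + p) \<le> (l\<^sup>2) ^ Suc (p + p)"
    using sparse_l_lower[OF dn] d1 by (intro power_mono) auto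
  also have "\<dots> = (l ^ Suc (p + p))\<^sup>2" by (simp only: mult.commute flip: power_mult)
  also have "\<dots> \<le> (d ^ (Suc p + Suc p) / n)\<^sup>2"
    using l l_nonneg by (intro power_mono) auto
  finally have "n\<^sup>2 * d ^ Suc (p + p) \<le> 2 ^ Suc (p + p) * (d ^ (Suc p + Suc p))\<^sup>2"
    using n_pos by (simp add: power_divide field_simps)
  also have "\<dots> = (2 ^ Suc (p + p) * d ^ Suc (Suc p + Suc p)) * d ^ Suc (p + p)"
    by (simp add: power_add power2_eq_square)
  finally have "n\<^sup>2 \<le> 2 ^ Suc (p + p) * d ^ Suc (Suc p + Suc p)"
    using d1 by (subst (asm) mult_le_cancel_right_pos) auto
  also have "\<dots> \<le> 2 ^ Suc (Suc p + Suc p) * d ^ Suc (Suc p + Suc p)"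
    using d1 by (intro mult_right_mono power_increasing) auto
  finally show ?thesis by (simp only: power_mult_distrib)
qed

end

section \<open>Balancing the error terms\<close>

context subkernel
begin

text \<open>The closed walks have main term \<open>\<gamma> * d ^ m\<close>. The condition on
  \<open>\<rho>\<close> absorbs errors proportional to \<open>\<rho> * d ^ m\<close>, the condition
  on \<open>d0\<close> absorbs multiples of \<open>d ^ (m - 1)\<close>, and the size of
  \<open>n\<close> ensures \<open>d0 \<le> d\<close>.\<close>

lemma odd_cycle_exists:
  fixes p :: nat and \<rho> \<delta> d0 :: real
  defines "m \<equiv> Suc (Suc p + Suc p)" and "\<gamma> \<equiv> \<delta> / 4 ^ Suc p"
  assumes \<delta>: "0 < \<delta>" and \<rho>: "0 < \<rho>" "\<rho> \<le> 1" "6 * (real m)\<^sup>2 * \<rho> \<le> \<gamma>"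
    and d0: "1 \<le> d0" "10 * (real m)\<^sup>2 < \<gamma> * d0" and n0: "(2 * d0) ^ m \<le> n"
    and d1: "1 \<le> d" and l: "l ^ Suc (p + p) \<le> \<rho> ^ Suc (p + p) * d ^ (Suc p + Suc p) / n"
    and w1: "(1 + \<delta>) / 2 * d * n \<le> walks B 1"
  obtains xs where "distinct xs" "set xs \<subseteq> V" "length xs = m" "cycle_weight B xs \<noteq> 0"
proof -
  have \<gamma>: "0 < \<gamma>" using \<delta> by (simp add: \<gamma>_def)
  have "l ^ Suc (p + p) \<le> \<rho> ^ Suc (p + p) * (d ^ Suc (p + p) * d) / n"
    using l by (simp add: mult_ac)
  also have "\<dots> \<le> \<rho> ^ Suc (p + p) * d ^ Suc (p + p)"
  proof -
    have "\<rho> ^ Suc (p + p) * d ^ Suc (p + p) * (d / n) \<le> \<rho> ^ Suc (p + p) * d ^ Suc (p + p) * 1"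
      using d_le_n d1 \<rho> n_pos by (intro mult_left_mono) auto
    then show ?thesis by (simp add: mult_ac)
  qed
  finally have "l ^ Suc (p + p) \<le> (\<rho> * d) ^ Suc (p + p)" by (simp only: power_mult_distrib)
  then have l\<rho>: "l \<le> \<rho> * d"
    using \<rho> d1 by (meson power_le_imp_le_base less_imp_le mult_nonneg_nonneg order_trans zero_le_one)
  also have "\<dots> \<le> 1 * d" using \<rho> d1 by (intro mult_right_mono) auto
  finally have ld: "l \<le> d" by simp
  \<comment> \<open>The full power of \<open>\<rho>\<close> was required for the root giving
    \<open>l \<le> \<rho> * d\<close>; from here on one factor is enough.\<close>
  have "\<rho> ^ Suc (p + p) \<le> \<rho> ^ 1" using \<rho> by (intro power_decreasing) auto
  then have "\<rho> ^ Suc (p + p) * d ^ (Suc p + Suc p) \<le> \<rho> * d ^ (Suc p + Suc p)"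
    using d1 by (intro mult_right_mono) auto
  moreover have "n * l ^ Suc (p + p) \<le> \<rho> ^ Suc (p + p) * d ^ (Suc p + Suc p)"
    using l n_pos by (simp add: pos_le_divide_eq mult.commute)
  ultimately have nl: "n * l ^ Suc (p + p) \<le> \<rho> * d ^ (Suc p + Suc p)" by linarith
  have "l * ktrace (kpow A (Suc p + Suc p)) \<le> l * (d ^ (Suc p + Suc p) + n * (l ^ (p + p) * d))"
    by (intro mult_left_mono trace_A_even_le l_nonneg)
  also have "\<dots> = l * d ^ (Suc p + Suc p) + (n * l ^ Suc (p + p)) * d"
    by (simp add: algebra_simps)
  also have "\<dots> \<le> (\<rho> * d) * d ^ (Suc p + Suc p) + (\<rho> * d ^ (Suc p + Suc p)) * d"
    using l\<rho> nl d1 by (intro add_mono mult_right_mono) auto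
  also have "\<dots> = 2 * \<rho> * d ^ m" by (simp add: m_def)
  finally have T: "l * ktrace (kpow A (Suc p + Suc p)) \<le> 2 * \<rho> * d ^ m" .
  have "\<gamma> * d ^ m - 6 * \<rho> * d ^ m
      \<le> \<delta> * d ^ m / 4 ^ Suc p - 3 * (l * ktrace (kpow A (Suc p + Suc p)))"
    using T by (simp add: \<gamma>_def)
  also have "\<dots> \<le> ktrace (kpow B m)"
    unfolding m_def using w1 \<delta> by (intro odd_closed_walks_ge) auto
  finally have tr: "\<gamma> * d ^ m - 6 * \<rho> * d ^ m \<le> ktrace (kpow B m)" .
  \<comment> \<open>The first summand serves the case \<open>d \<le> n / 2\<close>, the second the
    dense case.\<close>
  define X where "X = 2 * \<rho> * d ^ m + 2 * d ^ (m - 1)"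
  have X0: "0 \<le> X" using \<rho> d1 by (simp add: X_def)
  have X: "n * l ^ (m - 4) * d\<^sup>2 \<le> X" if m_ge: "4 \<le> m"
  proof -
    obtain q where q: "p = Suc q" using m_ge by (cases p) (auto simp: m_def)
    have m4: "m - 4 = Suc (q + q)" by (simp add: m_def q)
    show ?thesis
    proof (cases "d \<le> n / 2")
      case True
      have "n * l ^ (m - 4) * d\<^sup>2 = (n * l ^ Suc (q + q) * d) * d"
        by (simp add: m4 power2_eq_square)
      \<comment> \<open>Trading one \<open>d\<close> for \<open>2 * l\<^sup>2\<close> restores the
        exponent of \<open>l\<close> in \<open>nl\<close>.\<close>
      also have "\<dots> \<le> (n * l ^ Suc (q + q) * d) * (2 * l\<^sup>2)"
        using sparse_l_lower[OF True] l_nonneg d1 by (intro mult_left_mono) auto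
      also have "\<dots> = 2 * ((n * l ^ Suc (p + p)) * d)"
        by (simp add: q power2_eq_square mult_ac)
      also have "\<dots> \<le> 2 * ((\<rho> * d ^ (Suc p + Suc p)) * d)"
        using nl d1 by (intro mult_left_mono mult_right_mono) auto
      also have "\<dots> = 2 * \<rho> * d ^ m" by (simp add: m_def)
      also have "\<dots> \<le> X" using d1 by (simp add: X_def)
      finally show ?thesis .
    next
      case False
      then have "n * l ^ (m - 4) * d\<^sup>2 \<le> (2 * d) * d ^ (m - 4) * d\<^sup>2"
        using ld l_nonneg d1 by (intro mult_right_mono mult_mono power_mono) auto
      also have "\<dots> = 2 * d ^ (m - 1)" by (simp add: m_def q power2_eq_square)
      also have "\<dots> \<le> X" using \<rho> d1 by (simp add: X_def)
      finally show ?thesis .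
    qed
  qed
  \<comment> \<open>A smaller degree would give \<open>n\<^sup>2 \<le> n\<close> in the sparse case
    and \<open>n < 2 * d0\<close> in the dense case, both against the lower bound on
    \<open>n\<close>.\<close>
  have dd0: "d0 \<le> d"
  proof (rule ccontr)
    assume "\<not> d0 \<le> d"
    then have lt: "d < d0" by simp
    have n1: "2 * d0 \<le> (2 * d0) ^ m"
      using d0 self_le_power[of "2 * d0" m] by (simp add: m_def)
    show False
    proof (cases "d \<le> n / 2")
      case True
      have "\<rho> ^ Suc (p + p) * d ^ (Suc p + Suc p) / n \<le> 1 * d ^ (Suc p + Suc p) / n"
        using \<rho> d1 n_pos by (intro divide_right_mono mult_right_mono power_le_one) auto
      then have "n\<^sup>2 \<le> (2 * d) ^ m"
        unfolding m_def using l by (intro sparse_degree_lower[OF True d1]) simp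
      also have "\<dots> \<le> (2 * d0) ^ m" using lt d1 by (intro power_mono) auto
      also have "\<dots> \<le> n" by (rule n0)
      finally have "n * n \<le> n * 1" by (simp add: power2_eq_square)
      then have "n \<le> 1" using n_pos by (subst (asm) mult_le_cancel_left_pos) auto
      then show False using n1 n0 d0 by linarith
    next
      case False
      then show False using lt n1 n0 by linarith
    qed
  qed
  have dm: "0 < d ^ m" using d1 by simp
  have dm1: "d ^ (m - 1) * d0 \<le> d ^ m"
  proof -
    have "d ^ (m - 1) * d0 \<le> d ^ (m - 1) * d" using dd0 d1 by (intro mult_left_mono) auto
    then show ?thesis by (simp add: m_def mult_ac)
  qed
  have dmn: "d ^ m / n \<le> d ^ (m - 1)"
  proof -
    have "d ^ (m - 1) * (d / n) \<le> d ^ (m - 1) * 1"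
      using d_le_n d1 n_pos by (intro mult_left_mono) auto
    then show ?thesis by (simp add: m_def mult_ac)
  qed
  have m9: "6 \<le> (real m)\<^sup>2"
  proof -
    have "(3::real)\<^sup>2 \<le> (real m)\<^sup>2" by (intro power_mono) (auto simp: m_def)
    then show ?thesis by simp
  qed
  have "(real m)\<^sup>2 * (d ^ m / n + 2 * d ^ (m - 1) + X) < ktrace (kpow B m)"
  proof -
    have "(real m)\<^sup>2 * (d ^ m / n + 2 * d ^ (m - 1) + X)
        \<le> (real m)\<^sup>2 * (5 * d ^ (m - 1) + 2 * \<rho> * d ^ m)"
      using dmn by (intro mult_left_mono) (auto simp: X_def)
    also have "\<dots> = 5 * (real m)\<^sup>2 * d ^ (m - 1) + 2 * (real m)\<^sup>2 * \<rho> * d ^ m"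
      by (simp add: algebra_simps)
    also have "5 * (real m)\<^sup>2 * d ^ (m - 1) < \<gamma> / 2 * d ^ m"
    proof -
      have "5 * (real m)\<^sup>2 * d ^ (m - 1) < (\<gamma> / 2 * d0) * d ^ (m - 1)"
        using d0 d1 by (intro mult_strict_right_mono) auto
      also have "\<dots> = \<gamma> / 2 * (d ^ (m - 1) * d0)" by simp
      also have "\<dots> \<le> \<gamma> / 2 * d ^ m" using dm1 \<gamma> by (intro mult_left_mono) auto
      finally show ?thesis .
    qed
    also have "\<gamma> / 2 * d ^ m + 2 * (real m)\<^sup>2 * \<rho> * d ^ m \<le> \<gamma> * d ^ m - 6 * \<rho> * d ^ m"
    proof -
      \<comment> \<open>The two errors in \<open>\<rho>\<close> then sum to at most
        \<open>3 * (real m)\<^sup>2 * \<rho>\<close>, which is at most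
        \<open>\<gamma> / 2\<close>.\<close>
      have "6 * \<rho> \<le> (real m)\<^sup>2 * \<rho>" using m9 \<rho> by (intro mult_right_mono) auto
      then have "(\<gamma> / 2 + 2 * (real m)\<^sup>2 * \<rho>) * d ^ m \<le> (\<gamma> - 6 * \<rho>) * d ^ m"
        using \<rho>(3) dm by (intro mult_right_mono) auto
      then show ?thesis by (simp add: algebra_simps)
    qed
    finally show ?thesis using tr by simp
  qed
  from ex_distinct_cycle[OF ld _ X0 X this] show thesis using that by (auto simp: m_def)
qed

end

section \<open>Graphs\<close>

definition adj :: "'a set set \<Rightarrow> 'a kernel" where
  "adj E u v = (if {u, v} \<in> E then 1 else 0)"

lemma sum_adj_eq_card:
  assumes G: "simple_graph V E"
  shows "(\<Sum>v\<in>V. adj E u v) = real (card {e \<in> E. u \<in> e})"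
proof -
  have fin: "finite V" using G by (simp add: simple_graph_def)
  have "(\<Sum>v\<in>V. adj E u v) = real (card {v \<in> V. {u, v} \<in> E})"
    using fin by (simp add: adj_def sum.If_cases Int_def)
  also have "card {v \<in> V. {u, v} \<in> E} = card {e \<in> E. u \<in> e}"
  proof (rule bij_betw_same_card[where f = "\<lambda>v. {u, v}"], rule bij_betw_imageI)
    show "inj_on (\<lambda>v. {u, v}) {v \<in> V. {u, v} \<in> E}"
      by (auto simp: inj_on_def doubleton_eq_iff)
    show "(\<lambda>v. {u, v}) ` {v \<in> V. {u, v} \<in> E} = {e \<in> E. u \<in> e}"
    proof (intro equalityI subsetI)
      fix e assume e: "e \<in> {e \<in> E. u \<in> e}"
      then have "card e = 2" "e \<subseteq> V" using G by (auto simp: simple_graph_def)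
      then obtain x y where xy: "e = {x, y}" by (auto simp: card_2_iff)
      then have "\<exists>v. e = {u, v}" using e by (auto simp: doubleton_eq_iff)
      then show "e \<in> (\<lambda>v. {u, v}) ` {v \<in> V. {u, v} \<in> E}" using e \<open>e \<subseteq> V\<close> by auto
    qed auto
  qed
  finally show ?thesis .
qed

text \<open>Double counting of incidences between vertices and edges.\<close>

lemma sum_adj_eq_twice_card:
  assumes G: "simple_graph V E"
  shows "(\<Sum>u\<in>V. \<Sum>v\<in>V. adj E u v) = 2 * real (card E)"
proof -
  have fin: "finite V" and sub: "\<And>e. e \<in> E \<Longrightarrow> e \<subseteq> V" and two: "\<And>e. e \<in> E \<Longrightarrow> card e = 2"
    using G by (auto simp: simple_graph_def)
  have finE: "finite E" using sub fin by (meson PowI finite_Pow_iff finite_subset subsetI)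
  have "(\<Sum>u\<in>V. \<Sum>v\<in>V. adj E u v) = (\<Sum>u\<in>V. \<Sum>e\<in>E. if u \<in> e then 1 else 0)"
    using finE by (simp add: sum_adj_eq_card[OF G] sum.If_cases Int_def)
  also have "\<dots> = (\<Sum>e\<in>E. \<Sum>u\<in>V. if u \<in> e then 1 else 0)" by (rule sum.swap)
  also have "\<dots> = (\<Sum>e\<in>E. 2)"
  proof (rule sum.cong)
    fix e assume e: "e \<in> E"
    have "V \<inter> e = e" using sub[OF e] by auto
    then show "(\<Sum>u\<in>V. if u \<in> e then 1 else 0) = (2::real)"
      using fin two[OF e] by (simp add: sum.If_cases)
  qed simp
  finally show ?thesis by simp
qed

text \<open>This transfers the trace formula for matrices to kernels. The kernel power is unrolled
  on the right to match the recursion of matrix powers.\<close>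

lemma (in finite_vertices) kpow_adj_eq_adjacency_matrix_pow:
  assumes supp: "supported (adj E)" and vs: "distinct vs" "set vs = V" and ij: "i < length vs" "j < length vs"
  shows "kpow (adj E) p (vs ! i) (vs ! j) = (adjacency_matrix vs E ^\<^sub>m p) $$ (i, j)"
  using ij
proof (induction p arbitrary: j)
  case 0
  then show ?case using vs by (auto simp: adjacency_matrix_def nth_eq_iff_index_eq)
next
  case (Suc p)
  let ?M = "adjacency_matrix vs E" and ?n = "length vs"
  have M: "?M \<in> carrier_mat ?n ?n" by (simp add: adjacency_matrix_def)
  have adj_entry: "adj E (vs ! l) (vs ! j) = ?M $$ (l, j)" if "l < ?n" for l
    using that Suc.prems by (simp add: adjacency_matrix_def adj_def)
  have bij: "bij_betw ((!) vs) {..<?n} V"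
    using bij_betw_nth[OF vs(1) refl vs(2)[symmetric]] .
  have "kpow (adj E) (Suc p) (vs ! i) (vs ! j) = (kpow (adj E) p \<star> adj E) (vs ! i) (vs ! j)"
    by (simp only: kpow_Suc2[OF supp])
  also have "\<dots> = (\<Sum>l<?n. kpow (adj E) p (vs ! i) (vs ! l) * adj E (vs ! l) (vs ! j))"
    unfolding kmul_def by (rule sum.reindex_bij_betw[OF bij, symmetric])
  also have "\<dots> = (\<Sum>l<?n. (?M ^\<^sub>m p) $$ (i, l) * ?M $$ (l, j))"
    using Suc by (intro sum.cong) (simp_all add: adj_entry)
  also have "\<dots> = (?M ^\<^sub>m Suc p) $$ (i, j)"
    using pow_mat_Suc_entry[OF M Suc.prems] ..
  finally show ?case .
qed

text \<open>With at least two vertices there is an eigenvalue besides the first, whence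
  \<open>0 \<le> l\<close>. Even powers erase the signs of the eigenvalues.\<close>

lemma ndl_graph_pseudorandom:
  assumes G: "ndl_graph n d l V E" and n: "2 \<le> n"
  shows "pseudorandom V (adj E) (real d) l"
proof -
  have reg: "regular_graph d V E" and card: "card V = n"
    using G by (auto simp: ndl_graph_def)
  then have sg: "simple_graph V E" by (simp add: regular_graph_def)
  then have fin: "finite V" by (simp add: simple_graph_def)
  obtain vs es where vs: "distinct vs" "set vs = V"
    and es: "ordered_eigenvalues (adjacency_matrix vs E) es" "length es = n"
      "es ! 0 = real d" "\<And>i. i \<in> {1..<n} \<Longrightarrow> \<bar>es ! i\<bar> \<le> l"
    using G unfolding ndl_graph_def by blast
  have len: "length vs = n" using vs card distinct_card by force
  have l: "0 \<le> l" using es(4)[of 1] n by auto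
  interpret finite_vertices V by unfold_locales (rule fin)
  have supp: "supported (adj E)"
    using sg by (auto simp: supported_def adj_def simple_graph_def)
  have M: "adjacency_matrix vs E \<in> carrier_mat n n"
    by (simp add: adjacency_matrix_def len)
  have trace: "ktrace (kpow (adj E) p) = (\<Sum>i<n. (es ! i) ^ p)" for p
  proof -
    have "bij_betw ((!) vs) {..<n} V"
      using bij_betw_nth[OF vs(1) _ vs(2)[symmetric], of "{..<n}"] len by simp
    then have "ktrace (kpow (adj E) p) = (\<Sum>i<n. kpow (adj E) p (vs ! i) (vs ! i))"
      unfolding ktrace_def by (rule sum.reindex_bij_betw[symmetric])
    also have "\<dots> = (\<Sum>i<n. (adjacency_matrix vs E ^\<^sub>m p) $$ (i, i))"
      using kpow_adj_eq_adjacency_matrix_pow[OF supp vs] len by simp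
    also have "\<dots> = (\<Sum>e\<leftarrow>es. e ^ p)"
      using es(1) by (intro sum_diag_pow_eq_sum_list[OF M]) (simp add: ordered_eigenvalues_def)
    also have "\<dots> = (\<Sum>i<n. (es ! i) ^ p)"
      using es(2) by (simp add: sum_list_sum_nth lessThan_atLeast0)
    finally show ?thesis .
  qed
  show ?thesis
  proof
    show "V \<noteq> {}" using card n by auto
    show "supported (adj E)" by (rule supp)
    show "ksym (adj E)" by (simp add: ksym_def adj_def insert_commute)
    show "adj E u v \<in> {0, 1}" for u v by (simp add: adj_def)
    show "adj E v v = 0" for v using sg by (auto simp: adj_def simple_graph_def)
    show "(\<Sum>v\<in>V. adj E u v) = real d" if "u \<in> V" for u
      using sum_adj_eq_card[OF sg] reg that by (simp add: regular_graph_def)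
    show "0 \<le> l" by (rule l)
    fix j :: nat
    obtain n' where n': "n = Suc n'" using n by (cases n) auto
    have "(\<Sum>i<n'. (es ! Suc i) ^ (j + j)) \<le> (\<Sum>i<n'. l ^ (j + j))"
    proof (rule sum_mono)
      fix i assume "i \<in> {..<n'}"
      then have "\<bar>es ! Suc i\<bar> ^ (j + j) \<le> l ^ (j + j)" by (intro power_mono es(4)) (auto simp: n')
      then show "(es ! Suc i) ^ (j + j) \<le> l ^ (j + j)" by (simp add: power_even_abs)
    qed
    also have "\<dots> \<le> real (card V) * l ^ (j + j)"
      using l by (simp add: card n' mult_right_mono)
    finally show "ktrace (kpow (adj E) (j + j)) \<le> real d ^ (j + j) + real (card V) * l ^ (j + j)"
      unfolding trace n' by (simp only: sum.lessThan_Suc_shift es(3) comp_def add_left_mono)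
  qed
qed

text \<open>A nonzero product has nonzero factors, so consecutive vertices are adjacent; the first
  vertex appended at the end supplies the closing edge.\<close>

lemma contains_copy_cycle:
  assumes F: "simple_graph W F" and xs: "distinct xs" "length xs = m" "0 < m"
    and cw: "cycle_weight (adj F) xs \<noteq> 0"
  shows "contains_copy W F (cycle_verts m) (cycle_edges m)"
proof -
  let ?f = "\<lambda>i. xs ! i"
  have edge: "{xs ! i, xs ! ((i + 1) mod m)} \<in> F" if i: "i < m" for i
  proof -
    have "adj F ((xs @ [hd xs]) ! i) ((xs @ [hd xs]) ! Suc i) \<noteq> 0"
      using path_weight_nonzero_nth[of "adj F" "xs @ [hd xs]" i] cw i xs
      by (simp add: cycle_weight_def)
    moreover have "(xs @ [hd xs]) ! Suc i = xs ! ((i + 1) mod m)"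
    proof (cases "Suc i < m")
      case True
      then show ?thesis using xs by (simp add: nth_append)
    next
      case False
      then have "m = Suc i" using i by simp
      moreover have "xs \<noteq> []" using xs by auto
      ultimately show ?thesis using xs by (simp add: nth_append hd_conv_nth)
    qed
    moreover have "(xs @ [hd xs]) ! i = xs ! i" using i xs by (simp add: nth_append)
    ultimately have "adj F (xs ! i) (xs ! ((i + 1) mod m)) \<noteq> 0" by (simp only: not_False_eq_True)
    then show ?thesis by (simp add: adj_def split: if_splits)
  qed
  have "inj_on ?f (cycle_verts m)"
    using xs by (auto simp: cycle_verts_def inj_on_def nth_eq_iff_index_eq)
  moreover have "?f ` cycle_verts m \<subseteq> W"
  proof
    fix v assume "v \<in> ?f ` cycle_verts m"
    then obtain i where "i < m" "v = xs ! i" by (auto simp: cycle_verts_def)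
    moreover have "{xs ! i, xs ! ((i + 1) mod m)} \<subseteq> W" if "i < m" for i
      using edge[OF that] F unfolding simple_graph_def by blast
    ultimately show "v \<in> W" by blast
  qed
  moreover have "\<forall>e\<in>cycle_edges m. ?f ` e \<in> F"
    using edge by (auto simp: cycle_edges_def)
  ultimately show ?thesis unfolding contains_copy_def by blast
qed

text \<open>The hypothesis \<open>d \<ge> 1\<close> excludes the edgeless graph, which meets the
  other conditions with \<open>d = 0\<close> and \<open>l = 0\<close> but contains no cycle.\<close>

theorem theorem1p2:
  fixes k :: nat and \<delta> :: real
  assumes "k \<ge> 1" and "\<delta> > 0"
  shows "\<exists>\<eta>::real. \<eta> > 0 \<and> (\<exists>n\<^sub>0::nat.
    \<forall>(n::nat) (d::nat) (l::real) (V::'a set) (E::'a set set) (W::'a set) (F::'a set set).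
      n \<ge> n\<^sub>0 \<longrightarrow> d \<ge> 1 \<longrightarrow> ndl_graph n d l V E \<longrightarrow>
      l ^ (2 * k - 1) \<le> \<eta> * real d ^ (2 * k) / real n \<longrightarrow>
      subgraph_of W F V E \<longrightarrow>
      real (card F) \<ge> (1 / 2 + \<delta>) * (real d / real n) * real (n choose 2) \<longrightarrow>
      contains_copy W F (cycle_verts (2 * k + 1)) (cycle_edges (2 * k + 1)))"
proof -
  obtain p where k: "k = Suc p" using assms(1) by (cases k) auto
  define m where "m = Suc (Suc p + Suc p)"
  have exps: "2 * k - 1 = Suc (p + p)" "2 * k = Suc p + Suc p" "2 * k + 1 = m"
    by (simp_all add: k m_def)
  have m: "0 < real m" by (simp add: m_def)
  define \<gamma> where "\<gamma> = \<delta> / 4 ^ Suc p"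
  have \<gamma>: "0 < \<gamma>" using assms(2) by (simp add: \<gamma>_def)
  define \<rho> where "\<rho> = min 1 (\<gamma> / (6 * (real m)\<^sup>2))"
  have \<rho>: "0 < \<rho>" "\<rho> \<le> 1" using \<gamma> m by (auto simp: \<rho>_def)
  have "\<rho> \<le> \<gamma> / (6 * (real m)\<^sup>2)" by (simp add: \<rho>_def)
  then have \<rho>3: "6 * (real m)\<^sup>2 * \<rho> \<le> \<gamma>" using m by (simp add: field_simps)
  define d0 where "d0 = 10 * (real m)\<^sup>2 / \<gamma> + 1"
  have d0: "1 \<le> d0" "10 * (real m)\<^sup>2 < \<gamma> * d0"
    using \<gamma> by (auto simp: d0_def field_simps)
  \<comment> \<open>The first bound makes the degree at least \<open>d0\<close>; the second pays for
    passing from \<open>n - 1\<close> to \<open>n\<close> at the cost of half of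
    \<open>\<delta>\<close>.\<close>
  obtain n0 :: nat where n0: "max ((2 * d0) ^ m) (1 / \<delta> + 2) \<le> real n0"
    using real_arch_simple by blast
  show ?thesis
  proof (intro exI[of _ "\<rho> ^ Suc (p + p)"] exI[of _ n0] conjI allI impI)
    show "0 < \<rho> ^ Suc (p + p)" using \<rho> by simp
    fix n d :: nat and l :: real and V W :: "'a set" and E F :: "'a set set"
    assume n: "n0 \<le> n" and d: "1 \<le> d" and G: "ndl_graph n d l V E"
      and l: "l ^ (2 * k - 1) \<le> \<rho> ^ Suc (p + p) * real d ^ (2 * k) / real n"
      and sub: "subgraph_of W F V E"
      and F: "(1 / 2 + \<delta>) * (real d / real n) * real (n choose 2) \<le> real (card F)"
    have nn0: "real n0 \<le> real n" using n by simp
    have n\<delta>: "1 / \<delta> + 2 \<le> real n" and nd0: "(2 * d0) ^ m \<le> real n" using n0 nn0 by linarith+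
    have "0 < 1 / \<delta>" using assms(2) by simp
    then have n2: "2 \<le> n" using n\<delta> by linarith
    have card: "card V = n" using G by (simp add: ndl_graph_def)
    have sgE: "simple_graph V E" using G by (simp add: ndl_graph_def regular_graph_def)
    have sgW: "simple_graph W F" and FE: "F \<subseteq> E" using sub by (auto simp: subgraph_of_def)
    \<comment> \<open>The subgraph is viewed on all of \<open>V\<close>, its missing vertices being
      isolated, so that both kernels live on the same set.\<close>
    have sgF: "simple_graph V F" using sgE FE by (auto simp: simple_graph_def)
    interpret pseudorandom V "adj E" "real d" l by (rule ndl_graph_pseudorandom[OF G n2])
    interpret subkernel V "adj E" "real d" l "adj F"
      using FE by unfold_locales (auto simp: ksym_def adj_def insert_commute)
    have "walks (adj F) 1 = 2 * real (card F)"
      using sum_adj_eq_twice_card[OF sgF] kpow_1[OF supp_B]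
      by (simp add: walks_def ip_def app_def del: kpow.simps)
    also have "\<dots> \<ge> 2 * ((1 / 2 + \<delta>) * (real d / real n) * real (n choose 2))"
      using F by simp
    also have "2 * ((1 / 2 + \<delta>) * (real d / real n) * real (n choose 2))
        = real d * ((1 / 2 + \<delta>) * (real n - 1))"
    proof -
      have c2: "real (n choose 2) = real n * (real n - 1) / 2"
        using n2 by (simp add: choose_two real_of_nat_div of_nat_diff)
      show ?thesis unfolding c2 using n2 by (simp add: divide_simps)
    qed
    finally have w: "real d * ((1 / 2 + \<delta>) * (real n - 1)) \<le> walks (adj F) 1" .
    \<comment> \<open>After clearing denominators this is exactly
      \<open>1 / \<delta> + 2 \<le> real n\<close>.\<close>
    have "(1 + \<delta>) / 2 * real n \<le> (1 / 2 + \<delta>) * (real n - 1)"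
      using n\<delta> assms(2) by (simp add: field_simps)
    then have "real d * ((1 + \<delta>) / 2 * real n) \<le> real d * ((1 / 2 + \<delta>) * (real n - 1))"
      by (intro mult_left_mono) auto
    with w have w1: "(1 + \<delta>) / 2 * real d * real (card V) \<le> walks (adj F) 1"
      by (simp add: card mult_ac)
    obtain xs where "distinct xs" "length xs = m" "cycle_weight (adj F) xs \<noteq> 0"
    proof (rule odd_cycle_exists[where p = p and \<rho> = \<rho> and \<delta> = \<delta> and ?d0.0 = d0, folded m_def \<gamma>_def])
      show "l ^ Suc (p + p) \<le> \<rho> ^ Suc (p + p) * real d ^ (Suc p + Suc p) / real (card V)"
        using l[unfolded exps(1)] by (simp only: exps(2) card)
      show "1 \<le> real d" using d by simp
      show "(2 * d0) ^ m \<le> real (card V)" using nd0 by (simp only: card)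
    qed (use assms(2) \<rho> \<rho>3 d0 w1 in blast)+
    then show "contains_copy W F (cycle_verts (2 * k + 1)) (cycle_edges (2 * k + 1))"
      unfolding exps by (intro contains_copy_cycle[OF sgW]) (auto simp: m_def)
  qed
qed

end
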